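(* Let $K \subseteq \mathbb{R}^n$ be a compact, fat semialgebraic set. Then there exist constants $\epsilon_K > 0$, $\eta_K > 0$ and $N \geq n$ such that, for all $x \in K$ and all $0 < \delta \leq \epsilon_K$, $$\mathrm{vol}\left(K \cap B^n_\delta(x)\right) \geq \eta_K\, \delta^N\, \mathrm{vol}(B^n).$$
   Context: A set $K \subseteq \mathbb{R}^n$ is called fat if $K \subseteq \overline{\mathrm{int}\, K}$, i.e., the interior of $K$ is dense in $K$. Here $\mathrm{vol}$ is Lebesgue measure, $B^n_\delta(x)$ is the Euclidean ball in $\mathbb{R}^n$ centered at $x$ with radius $\delta$, and $B^n = B^n_1(0)$. *)

theory Defs
  imports "HOL-Analysis.Analysis"
begin

(* On "real ^ 'n" the predicate real_polynomial_function, which is generated from bounded linear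
   functionals and constants by sums and products, describes exactly the polynomials in the
   coordinates. *)
definition basic_semialgebraic :: "(real ^ 'n) set \<Rightarrow> bool" where
  "basic_semialgebraic S \<longleftrightarrow>
     (\<exists>F G. finite F \<and> finite G \<and>
        (\<forall>p \<in> F \<union> G. real_polynomial_function p) \<and>
        S = {x. (\<forall>p\<in>F. p x = 0) \<and> (\<forall>q\<in>G. q x > 0)})"

definition semialgebraic :: "(real ^ 'n) set \<Rightarrow> bool" where
  "semialgebraic S \<longleftrightarrow>
     (\<exists>\<C>. finite \<C> \<and> (\<forall>C\<in>\<C>. basic_semialgebraic C) \<and> S = \<Union>\<C>)"

definition fat :: "'a::topological_space set \<Rightarrow> bool" where
  "fat K \<longleftrightarrow> K \<subseteq> closure (interior K)"

end

theory Submission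
  imports Defs "HOL-Computational_Algebra.Polynomial"
begin

text \<open>
  By compactness and fatness, for every \<open>\<delta> > 0\<close> there is an \<open>r > 0\<close> such that every
  \<open>K \<inter> cball x \<delta>\<close> with \<open>x \<in> K\<close> contains a ball of radius \<open>r\<close>. This condition on \<open>(\<delta>, r)\<close> is
  a first-order formula over \<open>K\<close> with quantifiers ranging over a bounded box, so by quantifier
  elimination it depends only on the signs of finitely many polynomials in \<open>(\<delta>, r)\<close>. For fixed
  small \<open>\<delta>\<close> these signs do not change for \<open>0 < r \<le> c \<delta>\<^sup>N\<close>, since the term of lowest degree
  in \<open>r\<close> dominates there; hence \<open>r = c \<delta>\<^sup>N\<close> is admissible.

  Quantifier elimination is carried out semantically, following Cohen and Hoermander: if finitely
  many coefficient polynomials have the same signs at two parameters, then an increasing bijection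
  of the line aligns the sign diagrams of the two specialised families of univariate polynomials.
\<close>

section \<open>Aligning sign diagrams of univariate polynomials\<close>

text \<open>The map is the identity outside the interval and consists of two affine pieces inside,
  meeting at the point \<open>(v, w)\<close>. It later corrects an alignment in one gap without
  disturbing the others.\<close>

lemma exists_increasing_shift:
  fixes c d v w :: real
  assumes "c < v" "v < d" "c < w" "w < d"
  shows "\<exists>\<theta>::real \<Rightarrow> real. strict_mono \<theta> \<and> surj \<theta> \<and> \<theta> v = w \<and>
           (\<forall>t. t \<le> c \<or> d \<le> t \<longrightarrow> \<theta> t = t)"
proof -
  define \<theta> :: "real \<Rightarrow> real \<Rightarrow> real \<Rightarrow> real" where
    "\<theta> v w t = (if t \<le> c \<or> d \<le> t then t
       else if t \<le> v then c + (t - c) * ((w - c) / (v - c))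
       else d - (d - t) * ((d - w) / (d - v)))" for v w t
  \<comment> \<open>The inverse is the same construction with \<open>v\<close> and \<open>w\<close>
    exchanged; this gives surjectivity.\<close>
  have inv: "\<theta> v w (\<theta> w v t) = t" if vw: "c < v" "v < d" "c < w" "w < d" for v w t
  proof -
    consider "t \<le> c \<or> d \<le> t" | "c < t" "t \<le> w" | "w < t" "t < d" by linarith
    then show ?thesis
    proof cases
      case 1 then show ?thesis by (simp add: \<theta>_def)
    next
      case 2
      define s where "s = c + (t - c) * ((v - c) / (w - c))"
      have "(t - c) * (v - c) \<le> (w - c) * (v - c)" using 2 vw by (intro mult_right_mono) auto
      hence "s \<le> v" using 2 vw by (auto simp: s_def field_simps)
      moreover have "c < s" using 2 vw by (simp add: s_def)
      ultimately show ?thesis using 2 vw by (simp add: \<theta>_def flip: s_def) (simp add: s_def)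
    next
      case 3
      define s where "s = d - (d - t) * ((d - v) / (d - w))"
      have "(d - t) * (d - v) < (d - w) * (d - v)" using 3 vw by (intro mult_strict_right_mono) auto
      hence "v < s" using 3 vw by (auto simp: s_def divide_simps algebra_simps)
      moreover have "s < d" using 3 vw by (simp add: s_def)
      ultimately show ?thesis using 3 vw by (simp add: \<theta>_def flip: s_def) (simp add: s_def)
    qed
  qed
  have "strict_mono (\<theta> v w)"
  proof (rule strict_monoI)
    fix s t :: real assume st: "s < t"
    have A: "c < c + (t - c) * ((w - c) / (v - c))" if "c < t" for t using that assms by simp
    have B: "c + (t - c) * ((w - c) / (v - c)) \<le> w" if "t \<le> v" for t
    proof -
      have "(t - c) * ((w - c) / (v - c)) \<le> (v - c) * ((w - c) / (v - c))" using assms that by (intro mult_right_mono) auto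
      then show ?thesis using assms by simp
    qed
    have C: "d - (d - t) * ((d - w) / (d - v)) < d" if "t < d" for t using that assms by simp
    have D: "w < d - (d - t) * ((d - w) / (d - v))" if "v < t" for t
    proof -
      have "(d - t) * ((d - w) / (d - v)) < (d - v) * ((d - w) / (d - v))" using assms that by (intro mult_strict_right_mono) auto
      then show ?thesis using assms by simp
    qed
    have E: "(s - c) * ((w - c) / (v - c)) < (t - c) * ((w - c) / (v - c))"
      using assms st by (intro mult_strict_right_mono) auto
    have F: "(d - t) * ((d - w) / (d - v)) < (d - s) * ((d - w) / (d - v))"
      using assms st by (intro mult_strict_right_mono) auto
    show "\<theta> v w s < \<theta> v w t"
      unfolding \<theta>_def using st assms A[of s] A[of t] B[of s] B[of t] C[of s] C[of t] D[of s] D[of t] E F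
      by (smt (verit))
  qed
  moreover have "surj (\<theta> v w)"
    by (rule surjI[where f = "\<theta> w v"]) (use inv assms in auto)
  moreover have "\<theta> v w v = w" "\<forall>t. t \<le> c \<or> d \<le> t \<longrightarrow> \<theta> v w t = t" using assms by (auto simp: \<theta>_def)
  ultimately show ?thesis by blast
qed

section \<open>Sign changes of polynomials on intervals of monotonicity\<close>

lemma poly_strict_mono_interval:
  fixes p :: "real poly"
  assumes "\<And>t. a < t \<Longrightarrow> t < b \<Longrightarrow> poly (pderiv p) t > 0" and "a \<le> s" "s < t" "t \<le> b"
  shows "poly p s < poly p t"
proof -
  obtain z where "s < z" "z < t" "poly p t - poly p s = (t - s) * poly (pderiv p) z"
    using poly_MVT[OF \<open>s < t\<close>] by blast
  then show ?thesis using assms by (metis diff_gt_0_iff_gt le_less_trans less_le_trans mult_pos_pos)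
qed

text \<open>An increasing polynomial changes sign at most once between the endpoints, and the
  endpoint signs tell whether it does. If so, the pivots are the roots of \<open>p\<close> and
  \<open>q\<close>; otherwise both have the same constant sign in the interior and any interior
  points serve.\<close>

lemma monotone_sign_pivots_pos:
  fixes p q :: "real poly"
  assumes "a < b" "c < d"
    and p': "\<And>t. a < t \<Longrightarrow> t < b \<Longrightarrow> poly (pderiv p) t > 0"
    and q': "\<And>t. c < t \<Longrightarrow> t < d \<Longrightarrow> poly (pderiv q) t > 0"
    and ac: "sgn (poly p a) = sgn (poly q c)" and bd: "sgn (poly p b) = sgn (poly q d)"
  shows "\<exists>r s. a < r \<and> r < b \<and> c < s \<and> s < d \<and>
           (\<forall>t w. a < t \<and> t < b \<and> c < w \<and> w < d \<and> sgn (t - r) = sgn (w - s)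
              \<longrightarrow> sgn (poly p t) = sgn (poly q w))"
proof -
  have pm: "poly p s < poly p t" if "a \<le> s" "s < t" "t \<le> b" for s t
    using poly_strict_mono_interval[OF p'] that by blast
  have qm: "poly q s < poly q t" if "c \<le> s" "s < t" "t \<le> d" for s t
    using poly_strict_mono_interval[OF q'] that by blast
  have ex: "\<exists>r s. a < r \<and> r < b \<and> c < s \<and> s < d" using assms(1,2) dense by meson
  consider "poly p a \<ge> 0" | "poly p b \<le> 0" | "poly p a < 0" "poly p b > 0" by linarith
  then show ?thesis
  proof cases
    case 1
    hence "poly q c \<ge> 0" using ac by (metis sgn_le_0_iff sgn_less sgn_pos zero_le_sgn_iff)
    hence "poly p t > 0" "poly q w > 0" if "a < t" "t < b" "c < w" "w < d" for t w
      using 1 pm[of a t] qm[of c w] that by auto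
    then show ?thesis using ex by (metis sgn_pos)
  next
    case 2
    hence "poly q d \<le> 0" using bd by (metis sgn_le_0_iff)
    hence "poly p t < 0" "poly q w < 0" if "a < t" "t < b" "c < w" "w < d" for t w
      using 2 pm[of t b] qm[of w d] that by auto
    then show ?thesis using ex by (metis sgn_neg)
  next
    case 3
    hence "poly q c < 0" "poly q d > 0" using ac bd by (metis sgn_less, metis sgn_greater)
    obtain r where r: "a < r" "r < b" "poly p r = 0" using poly_IVT_pos[OF \<open>a < b\<close> 3] by blast
    obtain s where s: "c < s" "s < d" "poly q s = 0"
      using poly_IVT_pos[OF \<open>c < d\<close> \<open>poly q c < 0\<close> \<open>poly q d > 0\<close>] by blast
    have "sgn (poly p t) = sgn (t - r)" if "a < t" "t < b" for t
      using pm[of r t] pm[of t r] r that by (cases t r rule: linorder_cases) auto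
    moreover have "sgn (poly q w) = sgn (w - s)" if "c < w" "w < d" for w
      using qm[of s w] qm[of w s] s that by (cases w s rule: linorder_cases) auto
    ultimately show ?thesis using r s by metis
  qed
qed

lemma poly_no_root_sgn_eq:
  fixes p :: "real poly"
  assumes "\<And>t. a < t \<Longrightarrow> t < b \<Longrightarrow> poly p t \<noteq> 0" "a < s" "s < b" "a < t" "t < b"
  shows "sgn (poly p s) = sgn (poly p t)"
  using assms
proof (induction s t rule: linorder_wlog)
  case (le s t)
  show ?case
  proof (rule ccontr)
    assume neq: "sgn (poly p s) \<noteq> sgn (poly p t)"
    hence "s < t" using le.hyps by (cases "s = t") auto
    have "poly p s * poly p t < 0" using neq le.prems(1)[of s] le.prems(1)[of t] le.prems
      by (metis linorder_less_linear mult_less_0_iff sgn_neg sgn_pos)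
    then obtain z where "s < z" "z < t" "poly p z = 0" using poly_IVT[OF \<open>s < t\<close>] by blast
    then show False using le.prems by force
  qed
qed (metis)

text \<open>By the intermediate value theorem the derivative of \<open>p\<close> keeps one sign,
  which \<open>pq'\<close> passes on to the derivative of \<open>q\<close>. The decreasing case
  follows from the increasing one by negating both polynomials.\<close>

lemma monotone_sign_pivots:
  fixes p q :: "real poly"
  assumes "a < b" "c < d"
    and p': "\<And>t. a < t \<Longrightarrow> t < b \<Longrightarrow> poly (pderiv p) t \<noteq> 0"
    and pq': "\<And>t w. a < t \<Longrightarrow> t < b \<Longrightarrow> c < w \<Longrightarrow> w < d \<Longrightarrow> sgn (poly (pderiv p) t) = sgn (poly (pderiv q) w)"
    and ac: "sgn (poly p a) = sgn (poly q c)" and bd: "sgn (poly p b) = sgn (poly q d)"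
  shows "\<exists>r s. a < r \<and> r < b \<and> c < s \<and> s < d \<and>
           (\<forall>t w. a < t \<and> t < b \<and> c < w \<and> w < d \<and> sgn (t - r) = sgn (w - s)
              \<longrightarrow> sgn (poly p t) = sgn (poly q w))"
proof -
  obtain m where m: "a < m" "m < b" using dense[OF \<open>a < b\<close>] by blast
  obtain n where n: "c < n" "n < d" using dense[OF \<open>c < d\<close>] by blast
  have pm: "sgn (poly (pderiv p) t) = sgn (poly (pderiv p) m)" if "a < t" "t < b" for t
    using poly_no_root_sgn_eq[OF p'] m that by blast
  have qm: "sgn (poly (pderiv q) w) = sgn (poly (pderiv p) m)" if "c < w" "w < d" for w
    using pq' m that by metis
  consider "poly (pderiv p) m > 0" | "poly (pderiv p) m < 0" using p'[OF m] by linarith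
  then show ?thesis
  proof cases
    case 1
    show ?thesis
      by (rule monotone_sign_pivots_pos[OF \<open>a < b\<close> \<open>c < d\<close> _ _ ac bd]; use 1 pm qm in \<open>metis sgn_greater\<close>)
  next
    case 2
    have "\<exists>r s. a < r \<and> r < b \<and> c < s \<and> s < d \<and>
           (\<forall>t w. a < t \<and> t < b \<and> c < w \<and> w < d \<and> sgn (t - r) = sgn (w - s)
              \<longrightarrow> sgn (poly (- p) t) = sgn (poly (- q) w))"
    proof (rule monotone_sign_pivots_pos[OF \<open>a < b\<close> \<open>c < d\<close>])
      show "poly (pderiv (- p)) t > 0" if "a < t" "t < b" for t
        using pm[OF that] 2 by (simp add: pderiv_minus sgn_1_neg)
      show "poly (pderiv (- q)) t > 0" if "c < t" "t < d" for t
        using qm[OF that] 2 by (simp add: pderiv_minus sgn_1_neg)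
    qed (use ac bd in \<open>simp_all add: sgn_minus\<close>)
    then show ?thesis by (simp add: sgn_minus)
  qed
qed

section \<open>Increasing bijections of an interval and the extension of alignments\<close>

text \<open>The maps live on the whole line, which spares domain conditions in compositions and
  preimages. Fixing \<open>l\<close> and \<open>u\<close> makes the restriction an increasing
  bijection of \<open>{l..u}\<close>.\<close>

definition interval_automorphism :: "real \<Rightarrow> real \<Rightarrow> (real \<Rightarrow> real) \<Rightarrow> bool" where
  "interval_automorphism l u \<phi> \<longleftrightarrow> strict_mono \<phi> \<and> surj \<phi> \<and> \<phi> l = l \<and> \<phi> u = u"

lemma interval_automorphism_bounds:
  assumes "interval_automorphism l u \<phi>" "t \<in> {l..u}"
  shows "\<phi> t \<in> {l..u}"
  using assms strict_mono_less_eq[of \<phi>] unfolding interval_automorphism_def by (metis atLeastAtMost_iff)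

text \<open>Here \<open>h a\<close> is the successor of \<open>a\<close> in \<open>Z\<close>, and in each gap \<open>r a\<close> is to be sent to \<open>s a\<close>.\<close>

lemma interval_automorphism_through:
  assumes \<phi>: "interval_automorphism l u \<phi>" and Z: "l \<in> Z" "u \<in> Z"
    and "finite A"
    and gap: "\<And>a. a \<in> A \<Longrightarrow> a \<in> Z \<and> h a \<in> Z \<and> a < h a \<and> {a<..<h a} \<inter> Z = {}"
    and r: "\<And>a. a \<in> A \<Longrightarrow> a < r a \<and> r a < h a"
    and s: "\<And>a. a \<in> A \<Longrightarrow> \<phi> a < s a \<and> s a < \<phi> (h a)"
  shows "\<exists>\<psi>. interval_automorphism l u \<psi> \<and> (\<forall>z\<in>Z. \<psi> z = \<phi> z) \<and> (\<forall>a\<in>A. \<psi> (r a) = s a)"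
  using \<open>finite A\<close> gap r s
proof (induction A rule: finite_induct)
  case empty
  then show ?case using \<phi> by auto
next
  case (insert a A)
  have "\<exists>\<psi>. interval_automorphism l u \<psi> \<and> (\<forall>z\<in>Z. \<psi> z = \<phi> z) \<and> (\<forall>a\<in>A. \<psi> (r a) = s a)"
    by (rule insert.IH; rule insert.prems; simp)
  then obtain \<psi> where \<psi>: "interval_automorphism l u \<psi>" "\<forall>z\<in>Z. \<psi> z = \<phi> z" "\<forall>a\<in>A. \<psi> (r a) = s a"
    by blast
  have mono: "strict_mono \<psi>" "strict_mono \<phi>" using \<psi>(1) \<phi> by (auto simp: interval_automorphism_def)
  have a: "a \<in> Z" "h a \<in> Z" "a < h a" "{a<..<h a} \<inter> Z = {}" "a < r a" "r a < h a" "\<phi> a < s a" "s a < \<phi> (h a)"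
    using insert.prems by auto
  have "\<phi> a < \<psi> (r a)" "\<psi> (r a) < \<phi> (h a)"
    using a \<psi>(2) mono(1) by (metis strict_mono_less)+
  \<comment> \<open>The shift corrects the image of \<open>r a\<close> and moves nothing outside the
    image gap, so the values on \<open>Z\<close> and at the pivots already placed in other gaps
    survive.\<close>
  from exists_increasing_shift[OF this a(7,8)] obtain \<theta> where \<theta>: "strict_mono \<theta>" "surj \<theta>"
    "\<theta> (\<psi> (r a)) = s a" "\<And>t. t \<le> \<phi> a \<or> \<phi> (h a) \<le> t \<Longrightarrow> \<theta> t = t" by blast
  have fixZ: "\<theta> (\<phi> z) = \<phi> z" if "z \<in> Z" for z
  proof (rule \<theta>(4))
    have "z \<le> a \<or> h a \<le> z" using that a(4) by force
    then show "\<phi> z \<le> \<phi> a \<or> \<phi> (h a) \<le> \<phi> z" using mono by (simp add: strict_mono_less_eq)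
  qed
  have fixA: "\<theta> (s b) = s b" if "b \<in> A" for b
  proof (rule \<theta>(4))
    have b: "b \<in> Z" "h b \<in> Z" "b < h b" "{b<..<h b} \<inter> Z = {}" "\<phi> b < s b" "s b < \<phi> (h b)"
      using insert.prems that by auto
    have "b \<noteq> a" using that insert.hyps by auto
    then consider "h b \<le> a" | "h a \<le> b" using a b by (metis disjoint_iff greaterThanLessThan_iff linorder_less_linear not_le)
    then show "s b \<le> \<phi> a \<or> \<phi> (h a) \<le> s b"
    proof cases
      case 1
      hence "\<phi> (h b) \<le> \<phi> a" using mono(2) by (simp add: strict_mono_less_eq)
      then show ?thesis using b(6) by linarith
    next
      case 2
      hence "\<phi> (h a) \<le> \<phi> b" using mono(2) by (simp add: strict_mono_less_eq)
      then show ?thesis using b(5) by linarith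
    qed
  qed
  have "interval_automorphism l u (\<theta> \<circ> \<psi>)"
    using \<psi>(1,2) \<theta>(1,2) fixZ Z mono unfolding interval_automorphism_def
    by (metis comp_apply comp_surj strict_mono_o)
  moreover have "\<forall>z\<in>Z. (\<theta> \<circ> \<psi>) z = \<phi> z" "\<forall>b\<in>insert a A. (\<theta> \<circ> \<psi>) (r b) = s b"
    using \<psi> fixZ fixA \<theta>(3) by auto
  ultimately show ?case by blast
qed

text \<open>
  Between consecutive roots of the \<open>f i\<close>, which include those of \<open>pderiv p\<close>, the polynomial \<open>p\<close> is
  monotone, so it suffices to move \<open>\<phi>\<close> inside each gap such that roots of \<open>p\<close> go to roots of \<open>q\<close>.
\<close>

lemma extend_sign_alignment:
  fixes f g :: "'i \<Rightarrow> real poly" and p q :: "real poly"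
  assumes "l < u" and fin: "finite I" and \<phi>: "interval_automorphism l u \<phi>"
    and fg: "\<And>i t. i \<in> I \<Longrightarrow> t \<in> {l..u} \<Longrightarrow> sgn (poly (f i) t) = sgn (poly (g i) (\<phi> t))"
    and i0: "i0 \<in> I" "f i0 = pderiv p" "g i0 = pderiv q"
    and l: "sgn (poly p l) = sgn (poly q l)" and u: "sgn (poly p u) = sgn (poly q u)"
    and roots: "\<And>i t. i \<in> I \<Longrightarrow> f i \<noteq> 0 \<Longrightarrow> t \<in> {l..u} \<Longrightarrow> poly (f i) t = 0 \<Longrightarrow> sgn (poly p t) = sgn (poly q (\<phi> t))"
  shows "\<exists>\<psi>. interval_automorphism l u \<psi> \<and>
     (\<forall>i\<in>I. \<forall>t\<in>{l..u}. sgn (poly (f i) t) = sgn (poly (g i) (\<psi> t))) \<and>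
     (\<forall>t\<in>{l..u}. sgn (poly p t) = sgn (poly q (\<psi> t)))"
proof (cases "pderiv p = 0")
  case True
  \<comment> \<open>For constant \<open>p\<close>, alignment makes \<open>pderiv q\<close> vanish on
    the whole interval. Hence \<open>q\<close> is constant too, and \<open>\<phi>\<close> itself
    serves.\<close>
  have "poly (pderiv q) s = 0" if s: "s \<in> {l..u}" for s
  proof -
    obtain t where t: "\<phi> t = s" using \<phi> unfolding interval_automorphism_def by (metis surjD)
    have "t \<in> {l..u}" using s t \<phi> unfolding interval_automorphism_def
      by (metis atLeastAtMost_iff strict_mono_less_eq)
    then show ?thesis using fg[OF i0(1), of t] i0 True t by (simp add: sgn_zero_iff)
  qed
  hence "{l..u} \<subseteq> {s. poly (pderiv q) s = 0}" by blast
  hence "pderiv q = 0" using poly_roots_finite[of "pderiv q"] infinite_Icc[OF \<open>l < u\<close>] finite_subset by blast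
  then obtain c d where "p = [:c:]" "q = [:d:]" using True pderiv_iszero by metis
  then show ?thesis using l \<phi> fg by auto
next
  case False
  \<comment> \<open>Identically zero members are left out, since they would make \<open>Z\<close>
    infinite. The endpoints are included so that every other point of the interval lies in a gap
    between neighbours in \<open>Z\<close>.\<close>
  define Z where "Z = {l, u} \<union> {t\<in>{l..u}. \<exists>i\<in>I. f i \<noteq> 0 \<and> poly (f i) t = 0}"
  have "finite (\<Union>i\<in>{i\<in>I. f i \<noteq> 0}. {t. poly (f i) t = 0})"
    using fin by (intro finite_UN_I) (auto simp: poly_roots_finite)
  hence "finite {t\<in>{l..u}. \<exists>i\<in>I. f i \<noteq> 0 \<and> poly (f i) t = 0}" by (rule rev_finite_subset) auto
  hence finZ: "finite Z" by (simp add: Z_def)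
  have lu: "l \<in> Z" "u \<in> Z" "Z \<subseteq> {l..u}" using \<open>l < u\<close> by (auto simp: Z_def)
  have \<phi>': "strict_mono \<phi>" "surj \<phi>" "\<phi> l = l" "\<phi> u = u" using \<phi> by (auto simp: interval_automorphism_def)
  have pZ: "sgn (poly p z) = sgn (poly q (\<phi> z))" if "z \<in> Z" for z
    using that l u roots \<phi>' by (auto simp: Z_def)
  define h where "h a = Min {z\<in>Z. a < z}" for a
  have h: "h a \<in> Z" "a < h a" "{a<..<h a} \<inter> Z = {}" if "a \<in> Z - {u}" for a
  proof -
    have ne: "{z\<in>Z. a < z} \<noteq> {}" using that lu by fastforce
    show "h a \<in> Z" "a < h a" using Min_in[OF _ ne] finZ by (auto simp: h_def)
    have "h a \<le> z" if "z \<in> Z" "a < z" for z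
      unfolding h_def using finZ that by (intro Min_le) auto
    then show "{a<..<h a} \<inter> Z = {}" by (meson disjoint_iff greaterThanLessThan_iff leD)
  qed
  have in_gap: "\<exists>a\<in>Z - {u}. a < t \<and> t < h a" if "t \<in> {l..u} - Z" for t
  proof -
    define a where "a = Max {z\<in>Z. z < t}"
    have "{z\<in>Z. z < t} \<noteq> {}" using that lu by force
    from Max_in[OF _ this] have a: "a \<in> Z" "a < t" using finZ by (auto simp: a_def)
    have "a \<noteq> u" using a that by auto
    hence aZ: "a \<in> Z - {u}" using a by blast
    have "h a \<noteq> t" using h[OF aZ] that by blast
    moreover have "\<not> h a < t"
    proof
      assume "h a < t"
      hence "h a \<le> Max {z\<in>Z. z < t}" using finZ h(1)[OF aZ] by (intro Max_ge) auto
      hence "h a \<le> a" by (simp add: a_def)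
      then show False using h[OF aZ] by auto
    qed
    ultimately show ?thesis using a aZ by (intro bexI[of _ a]) auto
  qed
  have gap_sub: "{a<..<h a} \<subseteq> {l..u}" if "a \<in> Z - {u}" for a
  proof -
    have "l \<le> a" "h a \<le> u" using lu(3) h(1)[OF that] that by auto
    then show ?thesis by auto
  qed
  \<comment> \<open>Inside a gap each \<open>f i\<close> has constant sign, and so has
    \<open>g i\<close> on the image gap. Therefore \<open>\<phi>\<close> may be altered inside gaps
    without losing the alignment of the \<open>f i\<close> with the \<open>g i\<close>.\<close>
  have const: "sgn (poly (g i) (\<phi> t)) = sgn (poly (f i) t')"
    if "i \<in> I" "a \<in> Z - {u}" "a < t" "t < h a" "a < t'" "t' < h a" for i a t t'
  proof (cases "f i = 0")
    case True
    have "t \<in> {l..u}" using that(3,4) gap_sub[OF that(2)] by auto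
    then show ?thesis using True fg[OF that(1), of t] by simp
  next
    case False
    have sub: "{a<..<h a} \<subseteq> {l..u}" by (rule gap_sub[OF that(2)])
    have "sgn (poly (f i) t) = sgn (poly (f i) t')"
    proof (rule poly_no_root_sgn_eq)
      show "poly (f i) x \<noteq> 0" if "a < x" "x < h a" for x
      proof
        assume "poly (f i) x = 0"
        hence "x \<in> Z" using that sub False \<open>i \<in> I\<close> by (auto simp: Z_def)
        then show False using that h(3)[OF \<open>a \<in> Z - {u}\<close>] by auto
      qed
    qed (use that in auto)
    moreover have "t \<in> {l..u}" using sub that(3,4) by auto
    ultimately show ?thesis using fg[OF that(1)] by simp
  qed
  have preimage: "\<exists>t. a < t \<and> t < h a \<and> w = \<phi> t" if "\<phi> a < w" "w < \<phi> (h a)" for a w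
    using that \<phi>'(1,2) by (metis strict_mono_less surjD)
  define pivots where "pivots a r s \<longleftrightarrow> a < r \<and> r < h a \<and> \<phi> a < s \<and> s < \<phi> (h a) \<and>
           (\<forall>t w. a < t \<and> t < h a \<and> \<phi> a < w \<and> w < \<phi> (h a) \<and> sgn (t - r) = sgn (w - s)
              \<longrightarrow> sgn (poly p t) = sgn (poly q w))" for a r s
  have "\<exists>r s. pivots a r s" if a: "a \<in> Z - {u}" for a
    unfolding pivots_def
  proof (rule monotone_sign_pivots)
    show "a < h a" "\<phi> a < \<phi> (h a)" using h[OF a] \<phi>'(1) by (auto simp: strict_mono_less)
    show "poly (pderiv p) t \<noteq> 0" if "a < t" "t < h a" for t
    proof
      assume "poly (pderiv p) t = 0"
      hence "t \<in> Z" using that i0(1,2) False gap_sub[OF a] by (auto simp: Z_def intro!: bexI[of _ i0])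
      then show False using that h(3)[OF a] by auto
    qed
    show "sgn (poly (pderiv p) t) = sgn (poly (pderiv q) w)"
      if tw: "a < t" "t < h a" "\<phi> a < w" "w < \<phi> (h a)" for t w
    proof -
      obtain t' where "a < t'" "t' < h a" "w = \<phi> t'" using preimage[OF tw(3,4)] by blast
      then show ?thesis using const[OF i0(1) a _ _ tw(1,2)] i0(2,3) by simp
    qed
  qed (use a h(1)[OF a] pZ in auto)
  then obtain r s where "\<And>a. a \<in> Z - {u} \<Longrightarrow> pivots a (r a) (s a)" by metis
  hence rs: "a < r a" "r a < h a" "\<phi> a < s a" "s a < \<phi> (h a)"
    "\<And>t w. \<lbrakk>a < t; t < h a; \<phi> a < w; w < \<phi> (h a); sgn (t - r a) = sgn (w - s a)\<rbrakk>
       \<Longrightarrow> sgn (poly p t) = sgn (poly q w)" if "a \<in> Z - {u}" for a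
    using that unfolding pivots_def by blast+
  have "\<exists>\<psi>. interval_automorphism l u \<psi> \<and> (\<forall>z\<in>Z. \<psi> z = \<phi> z) \<and> (\<forall>a\<in>Z - {u}. \<psi> (r a) = s a)"
  proof (rule interval_automorphism_through[OF \<phi> lu(1,2), where h = h])
    show "finite (Z - {u})" using finZ by simp
    show "a \<in> Z \<and> h a \<in> Z \<and> a < h a \<and> {a<..<h a} \<inter> Z = {}" if "a \<in> Z - {u}" for a
      using h[OF that] that by blast
    show "a < r a \<and> r a < h a" "\<phi> a < s a \<and> s a < \<phi> (h a)" if "a \<in> Z - {u}" for a
      using rs(1-4)[OF that] by blast+
  qed
  then obtain \<psi> where \<psi>: "interval_automorphism l u \<psi>" "\<forall>z\<in>Z. \<psi> z = \<phi> z" "\<forall>a\<in>Z - {u}. \<psi> (r a) = s a"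
    by blast
  have \<psi>m: "strict_mono \<psi>" using \<psi>(1) by (simp add: interval_automorphism_def)
  have \<psi>gap: "\<phi> a < \<psi> t" "\<psi> t < \<phi> (h a)" if "a \<in> Z - {u}" "a < t" "t < h a" for a t
    using that \<psi>(2) \<psi>m h(1)[OF that(1)] by (metis DiffD1 strict_mono_less)+
  show ?thesis
  proof (intro exI[of _ \<psi>] conjI \<psi>(1) ballI)
    fix i t assume i: "i \<in> I" and t: "t \<in> {l..u}"
    show "sgn (poly (f i) t) = sgn (poly (g i) (\<psi> t))"
    proof (cases "t \<in> Z")
      case True
      then show ?thesis using \<psi>(2) fg i t by simp
    next
      case False
      then obtain a where a: "a \<in> Z - {u}" "a < t" "t < h a" using in_gap t by blast
      obtain t' where "a < t'" "t' < h a" "\<psi> t = \<phi> t'" using preimage[OF \<psi>gap[OF a]] by blast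
      then show ?thesis using const[OF i a(1) _ _ a(2,3)] by simp
    qed
  next
    fix t assume t: "t \<in> {l..u}"
    show "sgn (poly p t) = sgn (poly q (\<psi> t))"
    proof (cases "t \<in> Z")
      case True
      then show ?thesis using \<psi>(2) pZ by simp
    next
      case False
      then obtain a where a: "a \<in> Z - {u}" "a < t" "t < h a" using in_gap t by blast
      have "sgn (t - r a) = sgn (\<psi> t - s a)"
        using \<psi>(3) a(1) strict_mono_less[OF \<psi>m, of t "r a"] strict_mono_less[OF \<psi>m, of "r a" t]
        by (cases t "r a" rule: linorder_cases) auto
      then show ?thesis using rs(5)[OF a(1)] \<psi>gap[OF a] a by blast
    qed
  qed
qed

section \<open>Families of polynomials depending on parameters\<close>

text \<open>A polynomial in one variable whose coefficients are polynomials in the parameter. The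
  bound \<open>d\<close> is uniform and only formal: the true degree may drop at particular
  parameters.\<close>

definition poly_family :: "nat \<Rightarrow> ('a::real_normed_vector \<Rightarrow> real poly) set" where
  "poly_family d = {p. (\<forall>x. degree (p x) \<le> d) \<and> (\<forall>k. real_polynomial_function (\<lambda>x. coeff (p x) k))}"

lemma poly_family_mono: "p \<in> poly_family d \<Longrightarrow> d \<le> e \<Longrightarrow> p \<in> poly_family e"
  by (auto simp: poly_family_def intro: order_trans)

lemma degree_poly_family: "p \<in> poly_family d \<Longrightarrow> degree (p x) \<le> d"
  by (simp add: poly_family_def)

lemma coeff_poly_family: "p \<in> poly_family d \<Longrightarrow> real_polynomial_function (\<lambda>x. coeff (p x) k)"
  by (simp add: poly_family_def)

lemma coeff_poly_family_eq_0: "p \<in> poly_family d \<Longrightarrow> d < k \<Longrightarrow> coeff (p x) k = 0"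
  by (metis coeff_eq_0 degree_poly_family le_less_trans)

lemma poly_familyI:
  assumes "\<And>x k. d < k \<Longrightarrow> coeff (p x) k = 0" "\<And>k. real_polynomial_function (\<lambda>x. coeff (p x) k)"
  shows "p \<in> poly_family d"
  using assms by (auto simp: poly_family_def intro: degree_le)

lemma poly_poly_family:
  assumes "p \<in> poly_family d"
  shows "real_polynomial_function (\<lambda>x. poly (p x) t)"
proof -
  have "poly (p x) t = (\<Sum>k\<le>d. coeff (p x) k * t ^ k)" for x
  proof -
    have "poly (p x) t = (\<Sum>k\<le>degree (p x). coeff (p x) k * t ^ k)" by (simp add: poly_altdef)
    also have "\<dots> = (\<Sum>k\<le>d. coeff (p x) k * t ^ k)"
      using degree_poly_family[OF assms] by (intro sum.mono_neutral_left) (auto simp: coeff_eq_0)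
    finally show ?thesis .
  qed
  then show ?thesis
    by (simp, intro real_polynomial_function_sum real_polynomial_function.intros(2-4) coeff_poly_family[OF assms]) auto
qed

lemma poly_family_add: "p \<in> poly_family d \<Longrightarrow> q \<in> poly_family e \<Longrightarrow> (\<lambda>x. p x + q x) \<in> poly_family (max d e)"
  by (rule poly_familyI) (auto simp: coeff_poly_family_eq_0 intro!: real_polynomial_function.intros(2-4) coeff_poly_family)

lemma poly_family_mult:
  assumes "p \<in> poly_family d" "q \<in> poly_family e"
  shows "(\<lambda>x. p x * q x) \<in> poly_family (d + e)"
proof -
  have "degree (p x * q x) \<le> d + e" for x
    using degree_mult_le[of "p x" "q x"] degree_poly_family[OF assms(1), of x] degree_poly_family[OF assms(2), of x]
    by linarith
  then show ?thesis using assms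
    by (auto simp: poly_family_def coeff_mult intro!: real_polynomial_function_sum real_polynomial_function.intros(2-4))
qed

lemma poly_family_smult:
  "real_polynomial_function c \<Longrightarrow> p \<in> poly_family d \<Longrightarrow> (\<lambda>x. smult (c x) (p x)) \<in> poly_family d"
  by (rule poly_familyI) (auto simp: coeff_poly_family_eq_0 intro!: real_polynomial_function.intros(2-4) coeff_poly_family)

lemma poly_family_pderiv:
  assumes "p \<in> poly_family (Suc d)"
  shows "(\<lambda>x. pderiv (p x)) \<in> poly_family d"
  by (rule poly_familyI)
    (auto simp: coeff_pderiv coeff_poly_family_eq_0[OF assms] intro!: real_polynomial_function.intros(2-4) coeff_poly_family[OF assms])

text \<open>Induction on the generation of polynomial functions: a linear \<open>f\<close> gives
  \<open>f x + t * f b\<close>, and the closure properties of families handle sums and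
  products.\<close>

lemma real_polynomial_function_on_line:
  assumes "real_polynomial_function f"
  shows "\<exists>d. \<exists>p\<in>poly_family d. \<forall>x t. f (x + t *\<^sub>R b) = poly (p x) t"
  using assms
proof (induction rule: real_polynomial_function.induct)
  case (linear f)
  interpret f: bounded_linear f by fact
  have "(\<lambda>x. [:f x, f b:]) \<in> poly_family 1"
  proof (rule poly_familyI)
    show "real_polynomial_function (\<lambda>x. coeff [:f x, f b:] k)" for k
      by (cases k; cases "k - 1") (auto intro: real_polynomial_function.intros linear)
    show "coeff [:f x, f b:] k = 0" if "1 < k" for x k
      using that by (intro coeff_eq_0) (auto simp: degree_pCons_eq_if)
  qed
  then show ?case by (intro exI bexI[of _ "\<lambda>x. [:f x, f b:]"]) (auto simp: f.add f.scaleR)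
next
  case (const c)
  have "(\<lambda>x. [:c:]) \<in> poly_family 0"
    by (rule poly_familyI) (auto simp: coeff_pCons intro: real_polynomial_function.intros(2-4) split: nat.splits)
  then show ?case by (intro exI bexI[of _ "\<lambda>x. [:c:]"]) auto
next
  case (add f g)
  then obtain d p e q where "p \<in> poly_family d" "q \<in> poly_family e"
    "\<forall>x t. f (x + t *\<^sub>R b) = poly (p x) t" "\<forall>x t. g (x + t *\<^sub>R b) = poly (q x) t" by blast
  then show ?case using poly_family_add[of p d q e] by (intro exI bexI[of _ "\<lambda>x. p x + q x"]) auto
next
  case (mult f g)
  then obtain d p e q where "p \<in> poly_family d" "q \<in> poly_family e"
    "\<forall>x t. f (x + t *\<^sub>R b) = poly (p x) t" "\<forall>x t. g (x + t *\<^sub>R b) = poly (q x) t" by blast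
  then show ?case using poly_family_mult[of p d q e] by (intro exI bexI[of _ "\<lambda>x. p x * q x"]) auto
qed

section \<open>Signs at roots through pseudo-remainders\<close>

text \<open>Pseudo-division: multiplying by the formal leading coefficient of \<open>q\<close>
  instead of dividing by it keeps all coefficients polynomial in the parameter and tolerates its
  vanishing. Only values at roots of \<open>q\<close> are recorded, so no quotient appears.\<close>

lemma poly_family_pseudo_remainder:
  assumes q: "q \<in> poly_family (Suc j)" and p: "p \<in> poly_family m"
  shows "\<exists>N. \<exists>r\<in>poly_family j. \<forall>x t. poly (q x) t = 0 \<longrightarrow>
            coeff (q x) (Suc j) ^ N * poly (p x) t = poly (r x) t"
  using p
proof (induction m arbitrary: p)
  case 0
  then show ?case by (intro exI[of _ 0] bexI[of _ p]) (auto intro: poly_family_mono)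
next
  case (Suc m)
  show ?case
  proof (cases "m < j")
    case True
    then show ?thesis using Suc.prems by (intro exI[of _ 0] bexI[of _ p]) (auto intro: poly_family_mono)
  next
    case False
    \<comment> \<open>The coefficients of degree \<open>Suc m\<close> cancel, and at a root of
      \<open>q\<close> the subtracted multiple of \<open>q\<close> vanishes.\<close>
    define p1 where "p1 = (\<lambda>x. smult (coeff (q x) (Suc j)) (p x) - monom (coeff (p x) (Suc m)) (m - j) * q x)"
    have "p1 \<in> poly_family m"
    proof (rule poly_familyI)
      show "coeff (p1 x) k = 0" if "m < k" for x k
      proof (cases "k = Suc m")
        case True
        moreover have "Suc m - (m - j) = Suc j" using False by auto
        ultimately show ?thesis using False by (simp add: p1_def coeff_monom_mult)
      next
        case False
        then have "Suc m < k" "Suc j < k - (m - j)" using that \<open>\<not> m < j\<close> by auto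
        then show ?thesis
          using coeff_poly_family_eq_0[OF q] coeff_poly_family_eq_0[OF Suc.prems] by (simp add: p1_def coeff_monom_mult)
      qed
      show "real_polynomial_function (\<lambda>x. coeff (p1 x) k)" for k
        by (cases "m - j \<le> k")
           (auto simp: p1_def coeff_monom_mult
              intro!: real_polynomial_function_diff real_polynomial_function.intros(2-4) coeff_poly_family[OF q] coeff_poly_family[OF Suc.prems])
    qed
    from Suc.IH[OF this] obtain N r where r: "r \<in> poly_family j"
      "\<And>x t. poly (q x) t = 0 \<Longrightarrow> coeff (q x) (Suc j) ^ N * poly (p1 x) t = poly (r x) t" by blast
    have "coeff (q x) (Suc j) ^ Suc N * poly (p x) t = poly (r x) t" if "poly (q x) t = 0" for x t
      using r(2)[OF that] that by (simp add: p1_def mult_ac)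
    then show ?thesis using r(1) by blast
  qed
qed

definition same_signs :: "('a \<Rightarrow> real) set \<Rightarrow> 'a \<Rightarrow> 'a \<Rightarrow> bool" where
  "same_signs C x y \<longleftrightarrow> (\<forall>c\<in>C. sgn (c x) = sgn (c y))"

lemma same_signs_mono: "same_signs D x y \<Longrightarrow> C \<subseteq> D \<Longrightarrow> same_signs C x y"
  by (auto simp: same_signs_def)

lemma same_signs_sym: "same_signs C x y \<Longrightarrow> same_signs C y x"
  by (simp add: same_signs_def)

text \<open>A single \<open>r\<close> has to serve both parameters: comparing \<open>p x\<close>
  with \<open>p y\<close> at corresponding roots of \<open>q\<close> then reduces to comparing
  \<open>r x\<close> with \<open>r y\<close>, whose degree is lower.\<close>

definition root_signs_detected ::
  "('a::real_normed_vector \<Rightarrow> real poly) \<Rightarrow> ('a \<Rightarrow> real poly) \<Rightarrow> ('a \<Rightarrow> real poly) set \<Rightarrow> ('a \<Rightarrow> real) set \<Rightarrow> bool"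
  where
  "root_signs_detected p q R C \<longleftrightarrow> (\<forall>x y. same_signs C x y \<and> q x \<noteq> 0 \<longrightarrow>
     (\<exists>r\<in>R. \<forall>z\<in>{x, y}. \<forall>t. poly (q z) t = 0 \<longrightarrow> sgn (poly (p z) t) = sgn (poly (r z) t)))"

lemma root_signs_detectedE:
  assumes "root_signs_detected p q R C" "same_signs C x y" "q x \<noteq> 0"
  obtains r where "r \<in> R" "\<And>z t. z \<in> {x, y} \<Longrightarrow> poly (q z) t = 0 \<Longrightarrow> sgn (poly (p z) t) = sgn (poly (r z) t)"
  using assms unfolding root_signs_detected_def by meson

text \<open>
  The degree of \<open>q x\<close> depends on \<open>x\<close>, so one remainder is needed for each truncation of \<open>q\<close>; the
  signs of the coefficients of \<open>q\<close> tell which one applies.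
\<close>

lemma sgn_at_roots_by_remainders:
  assumes "q \<in> poly_family j" and p: "p \<in> poly_family m"
  shows "\<exists>R C. finite R \<and> R \<subseteq> poly_family (j - 1) \<and> finite C \<and> (\<forall>c\<in>C. real_polynomial_function c) \<and>
     root_signs_detected p q R C"
  using assms(1)
proof (induction j arbitrary: q)
  case 0
  have const: "q x = [:coeff (q x) 0:]" for x using degree_poly_family[OF 0, of x] by (simp add: degree_0_id)
  \<comment> \<open>A nonzero constant \<open>q x\<close> has no roots, so the condition is vacuous;
    the zero family only supplies some element of \<open>R\<close>.\<close>
  have "(\<lambda>x. [:0:]) \<in> poly_family 0"
    by (rule poly_familyI) (auto simp: coeff_pCons intro: real_polynomial_function.intros(2-4) split: nat.splits)
  moreover have "poly (q z) t \<noteq> 0" if "same_signs {\<lambda>x. coeff (q x) 0} x y" "q x \<noteq> 0" "z \<in> {x, y}" for x y z t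
  proof -
    have "coeff (q x) 0 \<noteq> 0" using that(2) const by (metis pCons_0_0)
    hence "coeff (q z) 0 \<noteq> 0" using that(1,3) by (auto simp: same_signs_def sgn_zero_iff)
    then show ?thesis by (subst const) simp
  qed
  ultimately have "root_signs_detected p q {\<lambda>x. [:0:]} {\<lambda>x. coeff (q x) 0}" "{\<lambda>x. [:0:]} \<subseteq> poly_family (0 - 1)"
    unfolding root_signs_detected_def by auto
  then show ?case using coeff_poly_family[OF 0, of 0]
    by (intro exI[of _ "{\<lambda>x. [:0:]}"] exI[of _ "{\<lambda>x. coeff (q x) 0}"]) auto
next
  case (Suc j)
  define a where "a x = coeff (q x) (Suc j)" for x
  have a: "real_polynomial_function a" using coeff_poly_family[OF Suc.prems] by (simp add: a_def[abs_def])
  define q' where "q' x = q x - monom (a x) (Suc j)" for x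
  have q': "q' \<in> poly_family j"
  proof (rule poly_familyI)
    show "coeff (q' x) k = 0" if "j < k" for x k
      using that coeff_poly_family_eq_0[OF Suc.prems, of k x] by (cases "k = Suc j") (auto simp: q'_def a_def)
    show "real_polynomial_function (\<lambda>x. coeff (q' x) k)" for k
      by (cases "k = Suc j") (auto simp: q'_def intro!: real_polynomial_function_diff coeff_poly_family[OF Suc.prems] a real_polynomial_function.intros(2-4))
  qed
  from Suc.IH[OF this] obtain R C where RC: "finite R" "R \<subseteq> poly_family (j - 1)" "finite C" "\<forall>c\<in>C. real_polynomial_function c"
    "root_signs_detected p q' R C" by blast
  obtain N r where r: "r \<in> poly_family j"
    "\<And>x t. poly (q x) t = 0 \<Longrightarrow> a x ^ N * poly (p x) t = poly (r x) t"
    using poly_family_pseudo_remainder[OF Suc.prems p] unfolding a_def by blast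
  (* The extra factor makes the power of a x even, so that it does not affect the sign. *)
  define r' where "r' = (\<lambda>x. smult (a x ^ N) (r x))"
  have r': "r' \<in> poly_family j" unfolding r'_def
    by (intro poly_family_smult real_polynomial_function_power a r)
  have sgn_r': "sgn (poly (p x) t) = sgn (poly (r' x) t)" if "a x \<noteq> 0" "poly (q x) t = 0" for x t
  proof -
    have "poly (r' x) t = (a x ^ N * a x ^ N) * poly (p x) t" using r(2)[OF that(2)] by (simp add: r'_def)
    moreover have "0 < a x ^ N * a x ^ N" using that(1) by (metis not_real_square_gt_zero power_not_zero)
    ultimately show ?thesis by (metis mult_1 sgn_mult sgn_pos)
  qed
  have "root_signs_detected p q (insert r' R) (insert a C)"
    unfolding root_signs_detected_def
  proof (intro allI impI)
    fix x y assume "same_signs (insert a C) x y \<and> q x \<noteq> 0"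
    hence same: "sgn (a x) = sgn (a y)" "same_signs C x y" and ne: "q x \<noteq> 0" by (auto simp: same_signs_def)
    have a_iff: "a x = 0 \<longleftrightarrow> a y = 0" using same(1) by (metis sgn_zero_iff)
    show "\<exists>r\<in>insert r' R. \<forall>z\<in>{x, y}. \<forall>t. poly (q z) t = 0 \<longrightarrow> sgn (poly (p z) t) = sgn (poly (r z) t)"
    proof (cases "a x = 0")
      case True
      hence eq: "q' x = q x" "q' y = q y" using a_iff by (auto simp: q'_def)
      obtain r where "r \<in> R" "\<And>z t. z \<in> {x, y} \<Longrightarrow> poly (q' z) t = 0 \<Longrightarrow> sgn (poly (p z) t) = sgn (poly (r z) t)"
        using root_signs_detectedE[OF RC(5) same(2)] eq ne by metis
      then show ?thesis using eq by (intro bexI[of _ r]) auto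
    next
      case False
      then show ?thesis using sgn_r' a_iff by (intro bexI[of _ r']) auto
    qed
  qed
  moreover have "finite (insert r' R)" "insert r' R \<subseteq> poly_family (Suc j - 1)" "finite (insert a C)"
    "\<forall>c\<in>insert a C. real_polynomial_function c"
    using RC r' a by (auto intro: poly_family_mono)
  ultimately show ?case by blast
qed

section \<open>Sign diagrams of parametrised families\<close>

text \<open>One \<open>\<phi>\<close> serves all members of \<open>S\<close>, so the relative order
  of roots of different members is captured too, not only the sign sequence of each.\<close>

definition sign_diagram_determined :: "real \<Rightarrow> real \<Rightarrow> ('a::real_normed_vector \<Rightarrow> real poly) set \<Rightarrow> bool" where
  "sign_diagram_determined l u S \<longleftrightarrow> (\<exists>C. finite C \<and> (\<forall>c\<in>C. real_polynomial_function c) \<and>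
     (\<forall>x y. same_signs C x y \<longrightarrow> (\<exists>\<phi>. interval_automorphism l u \<phi> \<and>
        (\<forall>p\<in>S. \<forall>t\<in>{l..u}. sgn (poly (p x) t) = sgn (poly (p y) (\<phi> t))))))"

text \<open>The reduction step of Cohen and Hoermander. Besides \<open>S\<close>, only polynomials
  of degree at most \<open>d\<close> are needed: the derivative of \<open>p\<close>, and remainders
  giving the sign of \<open>p\<close> at roots of that derivative and of members of
  \<open>S\<close>.\<close>

lemma sign_diagram_determined_insert:
  fixes S :: "('a::real_normed_vector \<Rightarrow> real poly) set"
  assumes "l < u" and S: "finite S" "S \<subseteq> poly_family (Suc d)" and p: "p \<in> poly_family (Suc d)"
    and IH: "\<And>R. finite R \<Longrightarrow> R \<subseteq> poly_family d \<Longrightarrow> sign_diagram_determined l u (S \<union> R)"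
  shows "sign_diagram_determined l u (insert p S)"
proof -
  define p' where "p' = (\<lambda>x. pderiv (p x))"
  have p': "p' \<in> poly_family d" unfolding p'_def by (rule poly_family_pderiv[OF p])
  define detects where "detects q R C \<longleftrightarrow> finite R \<and> R \<subseteq> poly_family d \<and> finite C \<and>
     (\<forall>c\<in>C. real_polynomial_function c) \<and> root_signs_detected p q R C" for q R C
  have "\<exists>R C. detects q R C" if "q \<in> insert p' S" for q
  proof -
    have "q \<in> poly_family (Suc d)" using that S(2) poly_family_mono[OF p'] by auto
    from sgn_at_roots_by_remainders[OF this p] show ?thesis unfolding detects_def by simp
  qed
  then obtain R C where "\<And>q. q \<in> insert p' S \<Longrightarrow> detects q (R q) (C q)" by metis
  hence RC: "finite (R q)" "R q \<subseteq> poly_family d" "finite (C q)" "\<forall>c\<in>C q. real_polynomial_function c"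
     "root_signs_detected p q (R q) (C q)" if "q \<in> insert p' S" for q
    using that unfolding detects_def by blast+
  define R' where "R' = insert p' (\<Union>q\<in>insert p' S. R q)"
  have "sign_diagram_determined l u (S \<union> R')"
  proof (rule IH)
    show "finite R'" using RC(1) S(1) by (auto simp: R'_def)
    show "R' \<subseteq> poly_family d" using RC(2) p' by (auto simp: R'_def)
  qed
  then obtain C0 where C0: "finite C0" "\<forall>c\<in>C0. real_polynomial_function c"
    "\<And>x y. same_signs C0 x y \<Longrightarrow> (\<exists>\<phi>. interval_automorphism l u \<phi> \<and>
        (\<forall>p\<in>S \<union> R'. \<forall>t\<in>{l..u}. sgn (poly (p x) t) = sgn (poly (p y) (\<phi> t))))"
    unfolding sign_diagram_determined_def by blast
  \<comment> \<open>The endpoints \<open>l\<close> and \<open>u\<close> need not be roots of any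
    member, so no remainder controls \<open>p\<close> there; its values at them are added as
    conditions.\<close>
  define C' where "C' = C0 \<union> (\<Union>q\<in>insert p' S. C q) \<union> {\<lambda>x. poly (p x) l, \<lambda>x. poly (p x) u}"
  have "finite C'" "\<forall>c\<in>C'. real_polynomial_function c"
    using C0(1,2) RC(3,4) S(1) poly_poly_family[OF p] by (auto simp: C'_def)
  moreover have "\<exists>\<psi>. interval_automorphism l u \<psi> \<and>
        (\<forall>q\<in>insert p S. \<forall>t\<in>{l..u}. sgn (poly (q x) t) = sgn (poly (q y) (\<psi> t)))"
    if same: "same_signs C' x y" for x y
  proof -
    obtain \<phi> where \<phi>: "interval_automorphism l u \<phi>"
        "\<And>p t. p \<in> S \<union> R' \<Longrightarrow> t \<in> {l..u} \<Longrightarrow> sgn (poly (p x) t) = sgn (poly (p y) (\<phi> t))"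
      using C0(3)[OF same_signs_mono[OF same]] unfolding C'_def by blast
    have "\<exists>\<psi>. interval_automorphism l u \<psi> \<and>
     (\<forall>i\<in>insert p' S. \<forall>t\<in>{l..u}. sgn (poly (i x) t) = sgn (poly (i y) (\<psi> t))) \<and>
     (\<forall>t\<in>{l..u}. sgn (poly (p x) t) = sgn (poly (p y) (\<psi> t)))"
    proof (rule extend_sign_alignment[OF \<open>l < u\<close> _ \<phi>(1)])
      show "finite (insert p' S)" using S(1) by simp
      show "sgn (poly (i x) t) = sgn (poly (i y) (\<phi> t))" if "i \<in> insert p' S" "t \<in> {l..u}" for i t
        using \<phi>(2) that by (auto simp: R'_def)
      show "p' \<in> insert p' S" "p' x = pderiv (p x)" "p' y = pderiv (p y)" by (auto simp: p'_def)
      show "sgn (poly (p x) l) = sgn (poly (p y) l)" "sgn (poly (p x) u) = sgn (poly (p y) u)"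
        using same by (auto simp: same_signs_def C'_def)
      fix q t assume q: "q \<in> insert p' S" "q x \<noteq> 0" "t \<in> {l..u}" "poly (q x) t = 0"
      have "same_signs (C q) x y" using same_signs_mono[OF same] q(1) by (auto simp: C'_def)
      then obtain r where r: "r \<in> R q" "\<And>z t. z \<in> {x, y} \<Longrightarrow> poly (q z) t = 0 \<Longrightarrow> sgn (poly (p z) t) = sgn (poly (r z) t)"
        using root_signs_detectedE[OF RC(5)[OF q(1)] _ q(2)] by metis
      \<comment> \<open>Alignment makes \<open>\<phi> t\<close> a root of \<open>q y\<close>. The
        sign of \<open>p\<close> then passes from \<open>t\<close> to \<open>\<phi> t\<close>
        through the common remainder \<open>r\<close>, which \<open>\<phi>\<close> aligns as
        well.\<close>
      have "sgn (poly (q y) (\<phi> t)) = sgn (poly (q x) t)" using \<phi>(2)[OF _ q(3)] q(1) by (auto simp: R'_def)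
      hence "poly (q y) (\<phi> t) = 0" using q(4) by (simp add: sgn_zero_iff)
      moreover have "sgn (poly (r x) t) = sgn (poly (r y) (\<phi> t))"
        using \<phi>(2)[OF _ q(3)] r(1) q(1) by (auto simp: R'_def)
      ultimately show "sgn (poly (p x) t) = sgn (poly (p y) (\<phi> t))" using r(2) q(4) by simp
    qed
    then show ?thesis by blast
  qed
  ultimately show ?thesis unfolding sign_diagram_determined_def by blast
qed

text \<open>Induction on the degree bound. Constants are aligned by the identity; in the step,
  members of degree up to \<open>Suc d\<close> are removed one at a time at the cost of finitely
  many of degree at most \<open>d\<close>.\<close>

theorem sign_diagram_determined:
  assumes "l < u" "finite S" "S \<subseteq> poly_family d"
  shows "sign_diagram_determined l u S"
  using assms(2,3)
proof (induction d arbitrary: S)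
  case 0
  define C where "C = (\<lambda>p x. coeff (p x) 0) ` S"
  have "finite C" "\<forall>c\<in>C. real_polynomial_function c"
    using 0 coeff_poly_family by (auto simp: C_def)
  moreover have "sgn (poly (p x) t) = sgn (poly (p y) t)" if "same_signs C x y" "p \<in> S" for x y p t
  proof -
    have "poly (p z) t = coeff (p z) 0" for z t
      using degree_poly_family[of p 0 z] that 0 by (auto simp: poly_altdef)
    then show ?thesis using that by (auto simp: same_signs_def C_def)
  qed
  moreover have "interval_automorphism l u id" by (simp add: interval_automorphism_def strict_mono_def)
  ultimately show ?case unfolding sign_diagram_determined_def by (metis id_apply)
next
  case (Suc d)
  \<comment> \<open>The set \<open>R\<close> stays arbitrary because each removal from
    \<open>S\<close> enlarges it by a derivative and remainders.\<close>
  have "sign_diagram_determined l u (S \<union> R)" if "finite R" "R \<subseteq> poly_family d" for R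
    using Suc.prems that
  proof (induction S arbitrary: R rule: finite_induct)
    case empty
    then show ?case using Suc.IH by simp
  next
    case (insert p S)
    have "sign_diagram_determined l u (insert p (S \<union> R))"
    proof (rule sign_diagram_determined_insert[OF \<open>l < u\<close>])
      show "S \<union> R \<subseteq> poly_family (Suc d)" using insert.prems by (auto intro: poly_family_mono)
      show "sign_diagram_determined l u (S \<union> R \<union> R')" if "finite R'" "R' \<subseteq> poly_family d" for R'
        using insert.IH[of "R \<union> R'"] insert.prems that by (simp add: Un_assoc)
    qed (use insert in auto)
    then show ?case by simp
  qed
  from this[of "{}"] show ?case by simp
qed

section \<open>Quantifier elimination over bounded intervals\<close>

text \<open>A semantic substitute for definability by a quantifier-free formula, which avoids any
  syntax of formulas. One implication is enough because \<open>same_signs\<close> is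
  symmetric.\<close>

definition sign_determined :: "('a::real_normed_vector \<Rightarrow> bool) \<Rightarrow> bool" where
  "sign_determined P \<longleftrightarrow> (\<exists>C. finite C \<and> (\<forall>c\<in>C. real_polynomial_function c) \<and>
     (\<forall>x y. same_signs C x y \<longrightarrow> P x \<longrightarrow> P y))"

lemma sign_determinedE:
  assumes "sign_determined P"
  obtains C where "finite C" "\<And>c. c \<in> C \<Longrightarrow> real_polynomial_function c"
    "\<And>x y. same_signs C x y \<Longrightarrow> P x \<longleftrightarrow> P y"
  using assms same_signs_sym unfolding sign_determined_def by metis

lemma sign_determinedI:
  assumes "finite C" "\<And>c. c \<in> C \<Longrightarrow> real_polynomial_function c"
    "\<And>x y. same_signs C x y \<Longrightarrow> P x \<Longrightarrow> P y"
  shows "sign_determined P"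
  using assms unfolding sign_determined_def by blast

lemma sign_determined_sgn:
  assumes "real_polynomial_function f"
  shows "sign_determined (\<lambda>x. Q (sgn (f x)))"
  by (rule sign_determinedI[of "{f}"]) (use assms in \<open>auto simp: same_signs_def\<close>)

lemma sign_determined_not:
  assumes "sign_determined P"
  shows "sign_determined (\<lambda>x. \<not> P x)"
proof -
  obtain C where "finite C" "\<And>c. c \<in> C \<Longrightarrow> real_polynomial_function c"
    "\<And>x y. same_signs C x y \<Longrightarrow> P x \<longleftrightarrow> P y" using sign_determinedE[OF assms] by blast
  then show ?thesis by (intro sign_determinedI[of C]) auto
qed

lemma sign_determined_conj:
  assumes "sign_determined P" "sign_determined Q"
  shows "sign_determined (\<lambda>x. P x \<and> Q x)"
proof -
  obtain C where C: "finite C" "\<And>c. c \<in> C \<Longrightarrow> real_polynomial_function c"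
    "\<And>x y. same_signs C x y \<Longrightarrow> P x \<longleftrightarrow> P y" using sign_determinedE[OF assms(1)] by blast
  obtain D where D: "finite D" "\<And>c. c \<in> D \<Longrightarrow> real_polynomial_function c"
    "\<And>x y. same_signs D x y \<Longrightarrow> Q x \<longleftrightarrow> Q y" using sign_determinedE[OF assms(2)] by blast
  show ?thesis
  proof (rule sign_determinedI[of "C \<union> D"])
    fix x y assume "same_signs (C \<union> D) x y" "P x \<and> Q x"
    then show "P y \<and> Q y" using C(3)[of x y] D(3)[of x y] by (simp add: same_signs_def)
  qed (use C D in auto)
qed

lemma sign_determined_imp:
  assumes "sign_determined P" "sign_determined Q"
  shows "sign_determined (\<lambda>x. P x \<longrightarrow> Q x)"
  using sign_determined_not[OF sign_determined_conj[OF assms(1) sign_determined_not[OF assms(2)]]] by simp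

lemma sign_determined_Ball:
  assumes "finite A" "\<And>a. a \<in> A \<Longrightarrow> sign_determined (P a)"
  shows "sign_determined (\<lambda>x. \<forall>a\<in>A. P a x)"
  using assms
proof (induction A rule: finite_induct)
  case empty
  then show ?case by (intro sign_determinedI[of "{}"]) auto
next
  case (insert a A)
  then show ?case using sign_determined_conj[of "P a" "\<lambda>x. \<forall>a\<in>A. P a x"] by simp
qed

lemma sign_determined_Bex:
  assumes "finite A" "\<And>a. a \<in> A \<Longrightarrow> sign_determined (P a)"
  shows "sign_determined (\<lambda>x. \<exists>a\<in>A. P a x)"
  using sign_determined_not[OF sign_determined_Ball[OF assms(1), of "\<lambda>a x. \<not> P a x"]] assms(2)
  by (simp add: sign_determined_not)

lemma sign_determined_compose_linear:
  fixes P :: "'b::euclidean_space \<Rightarrow> bool"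
  assumes "sign_determined P" "bounded_linear f"
  shows "sign_determined (\<lambda>x. P (f x))"
proof -
  obtain C where C: "finite C" "\<And>c. c \<in> C \<Longrightarrow> real_polynomial_function c"
    "\<And>x y. same_signs C x y \<Longrightarrow> P x \<longleftrightarrow> P y" using sign_determinedE[OF assms(1)] by blast
  show ?thesis
  proof (rule sign_determinedI[of "(\<lambda>c. c \<circ> f) ` C"])
    fix x y assume "same_signs ((\<lambda>c. c \<circ> f) ` C) x y" "P (f x)"
    then show "P (f y)" using C(3)[of "f x" "f y"] by (simp add: same_signs_def)
  qed (use C in \<open>auto intro!: real_polynomial_function_compose polynomial_function_bounded_linear assms(2)\<close>)
qed

text \<open>With squares on both sides the comparison becomes a sign condition on a single
  polynomial.\<close>

lemma sign_determined_norm_le: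
  fixes f :: "'a::real_normed_vector \<Rightarrow> 'b::euclidean_space" and g :: "'a \<Rightarrow> real"
  assumes f: "bounded_linear f" and g: "bounded_linear g"
  shows "sign_determined (\<lambda>x. (norm (f x))\<^sup>2 \<le> (g x)\<^sup>2)"
proof -
  have "real_polynomial_function (\<lambda>x. (g x)\<^sup>2 - (\<Sum>b\<in>Basis. (f x \<bullet> b)\<^sup>2))"
    by (intro real_polynomial_function_diff real_polynomial_function_sum real_polynomial_function_power
        real_polynomial_function.intros(1) g bounded_linear_inner_left_comp f) auto
  moreover have "(norm (f x))\<^sup>2 = (\<Sum>b\<in>Basis. (f x \<bullet> b)\<^sup>2)" for x
    unfolding power2_norm_eq_inner by (subst euclidean_inner) (simp add: power2_eq_square)
  ultimately have "real_polynomial_function (\<lambda>x. (g x)\<^sup>2 - (norm (f x))\<^sup>2)" by simp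
  from sign_determined_sgn[OF this, of "\<lambda>s. s \<ge> 0"] show ?thesis by simp
qed

section \<open>Elimination of bounded quantifiers\<close>

text \<open>Along the line, the polynomials deciding \<open>P\<close> become a univariate family
  with parameter \<open>x\<close>. An alignment \<open>\<phi>\<close> turns a witness
  \<open>t\<close> for \<open>x\<close> into the witness \<open>\<phi> t\<close> for
  \<open>y\<close>, still within the bounds.\<close>

lemma sign_determined_ex_line:
  assumes "l < u" "sign_determined P"
  shows "sign_determined (\<lambda>x. \<exists>t\<in>{l..u}. P (x + t *\<^sub>R b))"
proof -
  obtain C where C: "finite C" "\<And>c. c \<in> C \<Longrightarrow> real_polynomial_function c"
    "\<And>x y. same_signs C x y \<Longrightarrow> P x \<longleftrightarrow> P y" using sign_determinedE[OF assms(2)] by blast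
  have "\<exists>d p. p \<in> poly_family d \<and> (\<forall>x t. c (x + t *\<^sub>R b) = poly (p x) t)" if "c \<in> C" for c
    using real_polynomial_function_on_line[OF C(2)[OF that]] by blast
  then obtain d p where dp: "\<And>c. c \<in> C \<Longrightarrow> p c \<in> poly_family (d c)"
      "\<And>c x t. c \<in> C \<Longrightarrow> c (x + t *\<^sub>R b) = poly (p c x) t"
    by metis
  have "p ` C \<subseteq> poly_family (\<Sum>c\<in>C. d c)"
    using dp(1) poly_family_mono member_le_sum[of _ C d] C(1) by blast
  from sign_diagram_determined[OF \<open>l < u\<close> _ this] C(1)
  have "sign_diagram_determined l u (p ` C)" by blast
  then obtain D where D: "finite D" "\<forall>c\<in>D. real_polynomial_function c"
     "\<And>x y. same_signs D x y \<Longrightarrow> (\<exists>\<phi>. interval_automorphism l u \<phi> \<and>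
        (\<forall>p\<in>p ` C. \<forall>t\<in>{l..u}. sgn (poly (p x) t) = sgn (poly (p y) (\<phi> t))))"
    unfolding sign_diagram_determined_def by blast
  show ?thesis
  proof (rule sign_determinedI[of D])
    fix x y assume "same_signs D x y" "\<exists>t\<in>{l..u}. P (x + t *\<^sub>R b)"
    then obtain t \<phi> where t: "t \<in> {l..u}" "P (x + t *\<^sub>R b)" and \<phi>: "interval_automorphism l u \<phi>"
      "\<forall>p\<in>p ` C. \<forall>t\<in>{l..u}. sgn (poly (p x) t) = sgn (poly (p y) (\<phi> t))"
      using D(3) by blast
    have "same_signs C (x + t *\<^sub>R b) (y + \<phi> t *\<^sub>R b)"
      using \<phi>(2) t(1) dp(2) by (simp add: same_signs_def)
    then show "\<exists>t\<in>{l..u}. P (y + t *\<^sub>R b)"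
      using C(3) t(2) interval_automorphism_bounds[OF \<phi>(1) t(1)] by blast
  qed (use D in auto)
qed

lemma sign_determined_ex_sum:
  fixes b :: "'i \<Rightarrow> 'a::real_normed_vector"
  assumes "l < u" "finite I" "sign_determined P"
  shows "sign_determined (\<lambda>x. \<exists>v. (\<forall>i\<in>I. v i \<in> {l..u}) \<and> P (x + (\<Sum>i\<in>I. v i *\<^sub>R b i)))"
  using assms(2)
proof (induction I rule: finite_induct)
  case empty
  then show ?case using assms(3) by simp
next
  case (insert j I)
  have "(\<exists>v. (\<forall>i\<in>insert j I. v i \<in> {l..u}) \<and> P (x + (\<Sum>i\<in>insert j I. v i *\<^sub>R b i)))
     \<longleftrightarrow> (\<exists>t\<in>{l..u}. \<exists>v. (\<forall>i\<in>I. v i \<in> {l..u}) \<and> P (x + t *\<^sub>R b j + (\<Sum>i\<in>I. v i *\<^sub>R b i)))"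
    (is "?L \<longleftrightarrow> ?R") for x
  proof
    assume ?L
    then obtain v where "\<forall>i\<in>insert j I. v i \<in> {l..u}" "P (x + (\<Sum>i\<in>insert j I. v i *\<^sub>R b i))" by blast
    then show ?R using insert.hyps by (intro bexI[of _ "v j"] exI[of _ v]) (auto simp: add.assoc)
  next
    assume ?R
    then obtain t v where tv: "t \<in> {l..u}" "\<forall>i\<in>I. v i \<in> {l..u}" "P (x + t *\<^sub>R b j + (\<Sum>i\<in>I. v i *\<^sub>R b i))" by blast
    have "(\<Sum>i\<in>I. (v(j := t)) i *\<^sub>R b i) = (\<Sum>i\<in>I. v i *\<^sub>R b i)"
      using insert.hyps by (intro sum.cong) auto
    then show ?L using tv insert.hyps by (intro exI[of _ "v(j := t)"]) (simp add: add.assoc)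
  qed
  then show ?case using sign_determined_ex_line[OF \<open>l < u\<close> insert.IH, of "b j"] by simp
qed

text \<open>A bounded vector quantifier is a succession of bounded coordinate quantifiers, since
  \<open>g\<close> is determined by its values on the axes.\<close>

lemma sign_determined_ex_box:
  fixes g :: "real ^ 'n \<Rightarrow> 'a::real_normed_vector"
  assumes "l < u" "linear g" "sign_determined P"
  shows "sign_determined (\<lambda>x. \<exists>v. (\<forall>i. v $ i \<in> {l..u}) \<and> P (x + g v))"
proof -
  have g: "g v = (\<Sum>i\<in>UNIV. (v $ i) *\<^sub>R g (axis i 1))" for v
  proof -
    have "g v = g (\<Sum>i\<in>UNIV. (v $ i) *\<^sub>R axis i 1)" by (simp add: basis_expansion flip: scalar_mult_eq_scaleR)
    then show ?thesis by (simp add: linear_sum[OF assms(2)] linear_scale[OF assms(2)])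
  qed
  have "(\<exists>v. (\<forall>i. v $ i \<in> {l..u}) \<and> P (x + g v)) \<longleftrightarrow>
    (\<exists>v. (\<forall>i\<in>UNIV. v i \<in> {l..u}) \<and> P (x + (\<Sum>i\<in>UNIV. v i *\<^sub>R g (axis i 1))))" (is "?L \<longleftrightarrow> ?R") for x
  proof
    assume ?L
    then obtain v where "\<forall>i. v $ i \<in> {l..u}" "P (x + g v)" by blast
    then show ?R by (intro exI[of _ "\<lambda>i. v $ i"]) (simp flip: g[of v])
  next
    assume ?R
    then obtain v where "\<forall>i\<in>UNIV. v i \<in> {l..u}" "P (x + (\<Sum>i\<in>UNIV. v i *\<^sub>R g (axis i 1)))" by blast
    then show ?L by (intro exI[of _ "\<chi> i. v i"]) (simp add: g[of "\<chi> i. v i"])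
  qed
  then show ?thesis
    using sign_determined_ex_sum[OF assms(1) finite assms(3), of UNIV "\<lambda>i. g (axis i 1)"] by simp
qed

lemma sign_determined_all_box:
  fixes g :: "real ^ 'n \<Rightarrow> 'a::real_normed_vector"
  assumes "l < u" "linear g" "sign_determined P"
  shows "sign_determined (\<lambda>x. \<forall>v. (\<forall>i. v $ i \<in> {l..u}) \<longrightarrow> P (x + g v))"
proof -
  have "(\<forall>v. (\<forall>i. v $ i \<in> {l..u}) \<longrightarrow> P (x + g v)) \<longleftrightarrow> \<not> (\<exists>v. (\<forall>i. v $ i \<in> {l..u}) \<and> \<not> P (x + g v))" for x
    by blast
  then show ?thesis
    using sign_determined_not[OF sign_determined_ex_box[OF assms(1,2) sign_determined_not[OF assms(3)]]]
    by (simp only:)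
qed

lemma sign_determined_semialgebraic:
  assumes "semialgebraic K"
  shows "sign_determined (\<lambda>x. x \<in> K)"
proof -
  have basic: "sign_determined (\<lambda>x. x \<in> S)" if "basic_semialgebraic S" for S :: "(real ^ 'n) set"
  proof -
    from that obtain F G where FG: "finite F" "finite G" "\<And>p. p \<in> F \<union> G \<Longrightarrow> real_polynomial_function p"
      "S = {x. (\<forall>p\<in>F. p x = 0) \<and> (\<forall>q\<in>G. q x > 0)}" unfolding basic_semialgebraic_def by auto
    have "sign_determined (\<lambda>x. p x = 0)" "sign_determined (\<lambda>x. p x > 0)" if "p \<in> F \<union> G" for p
      using sign_determined_sgn[OF FG(3)[OF that], of "\<lambda>s. s = 0"]
        sign_determined_sgn[OF FG(3)[OF that], of "\<lambda>s. s > 0"] by (simp_all add: sgn_zero_iff)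
    then have "sign_determined (\<lambda>x. (\<forall>p\<in>F. p x = 0) \<and> (\<forall>q\<in>G. q x > 0))"
      using FG(1,2) by (intro sign_determined_conj sign_determined_Ball) auto
    then show ?thesis by (simp add: FG(4))
  qed
  obtain \<C> where \<C>: "finite \<C>" "\<And>C. C \<in> \<C> \<Longrightarrow> basic_semialgebraic C" "K = \<Union>\<C>"
    using assms unfolding semialgebraic_def by blast
  have "sign_determined (\<lambda>x. \<exists>C\<in>\<C>. x \<in> C)"
    by (rule sign_determined_Bex[OF \<C>(1)]) (rule basic[OF \<C>(2)])
  then show ?thesis by (simp add: \<C>(3))
qed

section \<open>Signs of polynomials near the origin\<close>

text \<open>On the unit interval every term beyond degree \<open>k\<close> is at most
  \<open>M * t ^ Suc k\<close>. The constant depends only on \<open>d\<close>, \<open>k\<close> and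
  \<open>M\<close>, so the bound is uniform over a family with bounded coefficients.\<close>

lemma poly_lowest_term_error:
  fixes p :: "real poly"
  assumes "degree p \<le> d" "\<And>j. j < k \<Longrightarrow> coeff p j = 0" "\<And>j. \<bar>coeff p j\<bar> \<le> M" "0 \<le> t" "t \<le> 1"
  shows "\<bar>poly p t - coeff p k * t ^ k\<bar> \<le> (real d + real k + 1) * M * t ^ Suc k"
proof -
  have "M \<ge> 0" using assms(3)[of 0] by linarith
  have "poly p t = (\<Sum>j\<le>degree p. coeff p j * t ^ j)" by (simp add: poly_altdef)
  \<comment> \<open>Padding the sum up to \<open>d + k\<close> keeps the index \<open>k\<close> in
    range even when it exceeds the degree.\<close>
  also have "\<dots> = (\<Sum>j\<le>d + k. coeff p j * t ^ j)"
    using assms(1) by (intro sum.mono_neutral_left) (auto simp: coeff_eq_0)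
  also have "\<dots> = coeff p k * t ^ k + (\<Sum>j\<in>{..d + k} - {k}. coeff p j * t ^ j)"
    by (subst sum.remove[of _ k]) auto
  finally have "\<bar>poly p t - coeff p k * t ^ k\<bar> = \<bar>\<Sum>j\<in>{..d + k} - {k}. coeff p j * t ^ j\<bar>" by simp
  also have "\<dots> \<le> (\<Sum>j\<in>{..d + k} - {k}. M * t ^ Suc k)"
  proof (rule order_trans[OF sum_abs sum_mono])
    fix j assume j: "j \<in> {..d + k} - {k}"
    show "\<bar>coeff p j * t ^ j\<bar> \<le> M * t ^ Suc k"
    proof (cases "j < k")
      case True
      then show ?thesis using assms \<open>M \<ge> 0\<close> by simp
    next
      case False
      hence "t ^ j \<le> t ^ Suc k" using j assms(4,5) by (intro power_decreasing) auto
      then show ?thesis using assms(3)[of j] assms(4) \<open>M \<ge> 0\<close>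
        by (simp only: abs_mult) (intro mult_mono, auto)
    qed
  qed
  also have "\<dots> = real (d + k) * (M * t ^ Suc k)" by simp
  also have "\<dots> \<le> (real d + real k + 1) * (M * t ^ Suc k)"
    using \<open>M \<ge> 0\<close> assms(4) by (intro mult_right_mono) auto
  finally show ?thesis by (simp add: mult.assoc)
qed

text \<open>Near 0 a nonzero polynomial is comparable to its lowest nonzero term: for
  \<open>t\<close> at most \<open>a / (2 * D)\<close> the remaining terms amount to at most half of
  it.\<close>

lemma poly_power_lower_bound:
  fixes p :: "real poly"
  assumes "p \<noteq> 0"
  shows "\<exists>\<epsilon> c. \<exists>N. 0 < \<epsilon> \<and> \<epsilon> \<le> 1 \<and> 0 < c \<and> (\<forall>t. 0 < t \<and> t \<le> \<epsilon> \<longrightarrow> c * t ^ N \<le> \<bar>poly p t\<bar>)"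
proof -
  have "\<exists>k. coeff p k \<noteq> 0" using assms leading_coeff_neq_0 by blast
  then obtain k where k: "coeff p k \<noteq> 0" "\<And>j. j < k \<Longrightarrow> coeff p j = 0"
    using exists_least_iff[of "\<lambda>k. coeff p k \<noteq> 0"] by blast
  define M where "M = (\<Sum>j\<le>degree p. \<bar>coeff p j\<bar>)"
  have M: "\<bar>coeff p j\<bar> \<le> M" for j
  proof (cases "j \<le> degree p")
    case True
    then show ?thesis unfolding M_def by (intro member_le_sum) auto
  next
    case False
    then show ?thesis by (simp add: coeff_eq_0 M_def sum_nonneg)
  qed
  define D where "D = (real (degree p) + real k + 1) * M"
  have "0 < M" using k(1) M[of k] by linarith
  hence "D > 0" by (simp add: D_def)
  define a where "a = \<bar>coeff p k\<bar>"
  have "a > 0" using k(1) by (simp add: a_def)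
  define \<epsilon> where "\<epsilon> = min 1 (a / (2 * D))"
  have "a / 2 * t ^ k \<le> \<bar>poly p t\<bar>" if t: "0 < t" "t \<le> \<epsilon>" for t
  proof -
    have "\<bar>poly p t - coeff p k * t ^ k\<bar> \<le> D * t ^ Suc k"
      unfolding D_def by (rule poly_lowest_term_error[OF order_refl k(2) M]) (use t in \<open>auto simp: \<epsilon>_def\<close>)
    also have "\<dots> = (D * t) * t ^ k" by simp
    also have "\<dots> \<le> a / 2 * t ^ k"
    proof (rule mult_right_mono)
      have "t \<le> a / (2 * D)" using t by (simp add: \<epsilon>_def)
      then show "D * t \<le> a / 2" using \<open>D > 0\<close> by (simp add: field_simps)
    qed (use t in auto)
    finally have 1: "\<bar>poly p t - coeff p k * t ^ k\<bar> \<le> a / 2 * t ^ k" .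
    have "\<bar>coeff p k * t ^ k\<bar> = a * t ^ k" using t by (simp add: a_def abs_mult)
    moreover have "a / 2 * t ^ k = (a * t ^ k) / 2" by simp
    ultimately show ?thesis using 1 by linarith
  qed
  moreover have "0 < \<epsilon>" "\<epsilon> \<le> 1" "0 < a / 2" using \<open>a > 0\<close> \<open>D > 0\<close> by (auto simp: \<epsilon>_def)
  ultimately show ?thesis by blast
qed

lemma poly_bounded_unit_interval:
  fixes p :: "real poly"
  shows "\<exists>B. \<forall>t\<in>{0..1}. \<bar>poly p t\<bar> \<le> B"
proof -
  have "compact (poly p ` {0..1})" by (intro compact_continuous_image continuous_intros compact_Icc)
  from compact_imp_bounded[OF this] show ?thesis by (simp add: bounded_iff)
qed

text \<open>As a polynomial in \<open>t\<close>, the function has coefficients \<open>q j\<close>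
  that are polynomials in \<open>s\<close>. Let \<open>k\<close> be the least index with
  \<open>q k\<close> not identically zero. Since \<open>q k\<close> is bounded below by a power of
  \<open>s\<close>, the term of degree \<open>k\<close> dominates for \<open>t\<close> below a
  constant times that power, and the sign is that of \<open>q k\<close> at \<open>s\<close>.\<close>

lemma sign_stable_below_power:
  fixes a b :: "'a::real_normed_vector"
  assumes "real_polynomial_function f"
  shows "\<exists>\<epsilon> c. \<exists>N. 0 < \<epsilon> \<and> \<epsilon> \<le> 1 \<and> 0 < c \<and> (\<forall>s t t'. 0 < s \<and> s \<le> \<epsilon> \<and> 0 < t \<and> t \<le> c * s ^ N \<and> 0 < t' \<and> t' \<le> c * s ^ N
     \<longrightarrow> sgn (f (s *\<^sub>R a + t *\<^sub>R b)) = sgn (f (s *\<^sub>R a + t' *\<^sub>R b)))"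
proof -
  obtain d p where p: "p \<in> poly_family d" "\<And>x t. f (x + t *\<^sub>R b) = poly (p x) t"
    using real_polynomial_function_on_line[OF assms] by blast
  have "\<exists>q. \<forall>s. coeff (p (s *\<^sub>R a)) k = poly q s" for k
  proof -
    obtain e r where "\<And>x s. coeff (p (x + s *\<^sub>R a)) k = poly (r x) s"
      using real_polynomial_function_on_line[OF coeff_poly_family[OF p(1), of k]] by blast
    from this[of 0] show ?thesis by auto
  qed
  then obtain q where q: "\<And>k s. coeff (p (s *\<^sub>R a)) k = poly (q k) s" by metis
  show ?thesis
  proof (cases "\<exists>k. q k \<noteq> 0")
    case False
    hence "p (s *\<^sub>R a) = 0" for s by (intro poly_eqI) (simp add: q)
    hence "\<forall>s t. f (s *\<^sub>R a + t *\<^sub>R b) = 0" by (simp add: p(2))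
    then show ?thesis by (intro exI[of _ 1]) auto
  next
    case True
    then obtain k where k: "q k \<noteq> 0" "\<And>j. j < k \<Longrightarrow> q j = 0"
      using exists_least_iff[of "\<lambda>k. q k \<noteq> 0"] by blast
    have "\<forall>j. \<exists>B. \<forall>s\<in>{0..1}. \<bar>poly (q j) s\<bar> \<le> B" using poly_bounded_unit_interval by blast
    from choice[OF this] obtain B where B: "\<And>j s. s \<in> {0..1} \<Longrightarrow> \<bar>poly (q j) s\<bar> \<le> B j" by blast
    \<comment> \<open>Coefficients beyond \<open>d\<close> vanish, so finitely many bounds suffice;
      the added 1 makes \<open>M\<close> positive, which permits dividing by
      \<open>D\<close>.\<close>
    define M where "M = 1 + (\<Sum>j\<le>d. B j)"
    have B0: "B j \<ge> 0" for j using B[of 0 j] by simp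
    have "M > 0" using sum_nonneg[of "{..d}" B] B0 by (simp add: M_def)
    have M: "\<bar>coeff (p (s *\<^sub>R a)) j\<bar> \<le> M" if "s \<in> {0..1}" for s j
    proof (cases "j \<le> d")
      case True
      have "B j \<le> (\<Sum>j\<le>d. B j)" using True B0 by (intro member_le_sum) auto
      then show ?thesis using B[OF that, of j] by (simp add: q M_def)
    next
      case False
      then show ?thesis using coeff_poly_family_eq_0[OF p(1)] \<open>M > 0\<close> by simp
    qed
    define D where "D = (real d + real k + 1) * M"
    have "D > 0" using \<open>M > 0\<close> by (simp add: D_def)
    obtain \<epsilon> c N where N: "0 < \<epsilon>" "\<epsilon> \<le> 1" "0 < c" "\<And>t. 0 < t \<Longrightarrow> t \<le> \<epsilon> \<Longrightarrow> c * t ^ N \<le> \<bar>poly (q k) t\<bar>"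
      using poly_power_lower_bound[OF k(1)] by blast
    \<comment> \<open>The bound 1 keeps \<open>t\<close> in the unit interval, as the error estimate
      requires; the other bound makes the error smaller than the dominant term.\<close>
    define c' where "c' = min 1 (c / (2 * D))"
    have "c' > 0" using N(3) \<open>D > 0\<close> by (simp add: c'_def)
    have "sgn (f (s *\<^sub>R a + t *\<^sub>R b)) = sgn (poly (q k) s)" if s: "0 < s" "s \<le> \<epsilon>" and t: "0 < t" "t \<le> c' * s ^ N" for s t
    proof -
      have s01: "s \<in> {0..1}" using s N(2) by auto
      hence "s ^ N \<le> 1" by (simp add: power_le_one)
      hence "c' * s ^ N \<le> 1 * 1" using s(1) by (intro mult_mono) (auto simp: c'_def)
      hence "t \<le> 1" using t by linarith
      define P where "P = p (s *\<^sub>R a)"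
      have "\<bar>poly P t - coeff P k * t ^ k\<bar> \<le> D * t ^ Suc k"
        unfolding D_def using k(2) t(1) \<open>t \<le> 1\<close> M[OF s01] degree_poly_family[OF p(1)]
        by (intro poly_lowest_term_error) (auto simp: P_def q)
      also have "\<dots> = (D * t) * t ^ k" by simp
      also have "\<dots> < c * s ^ N * t ^ k"
      proof (rule mult_strict_right_mono)
        have "t \<le> c / (2 * D) * s ^ N"
          using t(2) s(1) by (elim order_trans, intro mult_right_mono) (auto simp: c'_def)
        hence "D * t \<le> c * s ^ N / 2" using \<open>D > 0\<close> by (simp add: field_simps)
        moreover have "c * s ^ N > 0" using N(3) s(1) by simp
        ultimately show "D * t < c * s ^ N" by linarith
      qed (use t in auto)
      also have "\<dots> \<le> \<bar>coeff P k\<bar> * t ^ k"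
        using N(4)[OF s] t(1) by (intro mult_right_mono) (auto simp: P_def q)
      also have "\<dots> = \<bar>coeff P k * t ^ k\<bar>" using t(1) by (simp add: abs_mult)
      finally have "\<bar>poly P t - coeff P k * t ^ k\<bar> < \<bar>coeff P k * t ^ k\<bar>" .
      moreover have "sgn x = sgn y" if "\<bar>x - y\<bar> < \<bar>y\<bar>" for x y :: real
        using that by (auto simp: sgn_if abs_if split: if_splits)
      ultimately have "sgn (poly P t) = sgn (coeff P k * t ^ k)" by blast
      then show ?thesis using t(1) by (simp add: sgn_mult p(2) P_def q)
    qed
    then have "\<forall>s t t'. 0 < s \<and> s \<le> \<epsilon> \<and> 0 < t \<and> t \<le> c' * s ^ N \<and> 0 < t' \<and> t' \<le> c' * s ^ N
     \<longrightarrow> sgn (f (s *\<^sub>R a + t *\<^sub>R b)) = sgn (f (s *\<^sub>R a + t' *\<^sub>R b))" by simp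
    then show ?thesis using N(1,2) \<open>c' > 0\<close> by blast
  qed
qed

text \<open>For \<open>s\<close> at most 1, decreasing \<open>\<epsilon>\<close> and
  \<open>c\<close> and increasing \<open>N\<close> only shrinks the region, so the constants of
  finitely many polynomials can be merged.\<close>

lemma same_signs_below_power:
  fixes a b :: "'a::real_normed_vector"
  assumes "finite C" "\<And>f. f \<in> C \<Longrightarrow> real_polynomial_function f"
  shows "\<exists>\<epsilon> c. \<exists>N. 0 < \<epsilon> \<and> \<epsilon> \<le> 1 \<and> 0 < c \<and> (\<forall>s t t'. 0 < s \<and> s \<le> \<epsilon> \<and> 0 < t \<and> t \<le> c * s ^ N \<and> 0 < t' \<and> t' \<le> c * s ^ N
     \<longrightarrow> same_signs C (s *\<^sub>R a + t *\<^sub>R b) (s *\<^sub>R a + t' *\<^sub>R b))"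
  using assms
proof (induction C rule: finite_induct)
  case empty
  show ?case by (intro exI[of _ 1]) (simp add: same_signs_def)
next
  case (insert f C)
  obtain \<epsilon>1 c1 N1 where 1: "0 < \<epsilon>1" "\<epsilon>1 \<le> 1" "0 < c1" "\<And>s t t'. \<lbrakk>0 < s; s \<le> \<epsilon>1; 0 < t; t \<le> c1 * s ^ N1; 0 < t'; t' \<le> c1 * s ^ N1\<rbrakk>
     \<Longrightarrow> sgn (f (s *\<^sub>R a + t *\<^sub>R b)) = sgn (f (s *\<^sub>R a + t' *\<^sub>R b))"
    using sign_stable_below_power[OF insert.prems[OF insertI1]] by blast
  obtain \<epsilon>2 c2 N2 where 2: "0 < \<epsilon>2" "0 < c2" "\<And>s t t'. \<lbrakk>0 < s; s \<le> \<epsilon>2; 0 < t; t \<le> c2 * s ^ N2; 0 < t'; t' \<le> c2 * s ^ N2\<rbrakk>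
     \<Longrightarrow> same_signs C (s *\<^sub>R a + t *\<^sub>R b) (s *\<^sub>R a + t' *\<^sub>R b)"
    using insert.IH[OF insert.prems[OF insertI2]] by blast
  define \<epsilon> where "\<epsilon> = min \<epsilon>1 \<epsilon>2"
  define c where "c = min c1 c2"
  define N where "N = max N1 N2"
  have "same_signs (insert f C) (s *\<^sub>R a + t *\<^sub>R b) (s *\<^sub>R a + t' *\<^sub>R b)"
    if st: "0 < s" "s \<le> \<epsilon>" "0 < t" "t \<le> c * s ^ N" "0 < t'" "t' \<le> c * s ^ N" for s t t'
  proof -
    have s: "s \<le> \<epsilon>1" "s \<le> \<epsilon>2" "s \<le> 1" using st(2) 1(2) by (auto simp: \<epsilon>_def)
    have "s ^ N \<le> s ^ N1" "s ^ N \<le> s ^ N2"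
      using st(1) s(3) by (intro power_decreasing; simp add: N_def)+
    hence le: "c * s ^ N \<le> c1 * s ^ N1" "c * s ^ N \<le> c2 * s ^ N2"
      using st(1) 1(3) 2(2) by (intro mult_mono; simp add: c_def)+
    have "sgn (f (s *\<^sub>R a + t *\<^sub>R b)) = sgn (f (s *\<^sub>R a + t' *\<^sub>R b))"
      by (rule 1(4)[OF st(1) s(1) st(3) order_trans[OF st(4) le(1)] st(5) order_trans[OF st(6) le(1)]])
    moreover have "same_signs C (s *\<^sub>R a + t *\<^sub>R b) (s *\<^sub>R a + t' *\<^sub>R b)"
      by (rule 2(3)[OF st(1) s(2) st(3) order_trans[OF st(4) le(2)] st(5) order_trans[OF st(6) le(2)]])
    ultimately show ?thesis by (simp add: same_signs_def)
  qed
  moreover have "0 < \<epsilon>" "\<epsilon> \<le> 1" "0 < c" using 1 2 by (auto simp: \<epsilon>_def c_def)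
  ultimately show ?case by blast
qed

section \<open>Inner balls of fat semialgebraic sets\<close>

text \<open>Fatness puts an inner ball within distance \<open>\<delta> / 2\<close> of each point,
  and a finite cover by balls of radius \<open>\<delta> / 2\<close> makes its radius uniform.
  Nothing is said yet about how \<open>r\<close> depends on \<open>\<delta>\<close>.\<close>

lemma compact_fat_uniform_inner_ball:
  fixes K :: "'a::euclidean_space set"
  assumes "compact K" "fat K" "0 < \<delta>"
  shows "\<exists>r>0. \<forall>x\<in>K. \<exists>y. cball y r \<subseteq> K \<inter> cball x \<delta>"
proof -
  have "\<exists>y r. r > 0 \<and> cball y r \<subseteq> K \<inter> cball x (\<delta> / 2)" if "x \<in> K" for x
  proof -
    have "x \<in> closure (interior K)" using assms(2) that by (auto simp: fat_def)
    then obtain y where y: "y \<in> interior K" "dist y x < \<delta> / 2"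
      using assms(3) by (metis closure_approachable half_gt_zero)
    hence "y \<in> interior K \<inter> ball x (\<delta> / 2)" by (simp add: dist_commute)
    moreover have "open (interior K \<inter> ball x (\<delta> / 2))" by auto
    ultimately obtain r where "r > 0" "cball y r \<subseteq> interior K \<inter> ball x (\<delta> / 2)"
      using open_contains_cball by metis
    then show ?thesis using interior_subset ball_subset_cball by blast
  qed
  then obtain y r where yr: "\<And>x. x \<in> K \<Longrightarrow> r x > 0" "\<And>x. x \<in> K \<Longrightarrow> cball (y x) (r x) \<subseteq> K \<inter> cball x (\<delta> / 2)" by metis
  obtain F where F: "F \<subseteq> K" "finite F" "K \<subseteq> (\<Union>x\<in>F. ball x (\<delta> / 2))"
  proof (rule compactE_image[OF assms(1), of K "\<lambda>x. ball x (\<delta> / 2)"])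
    show "K \<subseteq> (\<Union>x\<in>K. ball x (\<delta> / 2))" using assms(3) by force
  qed auto
  \<comment> \<open>The inserted 1 keeps the minimum meaningful when \<open>K\<close>, and hence
    possibly \<open>F\<close>, is empty.\<close>
  define \<rho> where "\<rho> = Min (insert 1 (r ` F))"
  have "\<rho> > 0" using F yr by (auto simp: \<rho>_def)
  moreover have "\<exists>y. cball y \<rho> \<subseteq> K \<inter> cball x \<delta>" if x: "x \<in> K" for x
  proof -
    obtain z where "z \<in> F" "x \<in> ball z (\<delta> / 2)" using F(3) x by blast
    hence z: "z \<in> F" "dist z x < \<delta> / 2" by auto
    have "\<rho> \<le> r z" using F(2) z(1) by (simp add: \<rho>_def)
    hence "cball (y z) \<rho> \<subseteq> cball (y z) (r z)" by (rule subset_cball)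
    also have "\<dots> \<subseteq> K \<inter> cball z (\<delta> / 2)" using yr(2) z(1) F(1) by blast
    also have "\<dots> \<subseteq> K \<inter> cball x \<delta>"
    proof -
      have "cball z (\<delta> / 2) \<subseteq> cball x \<delta>"
      proof
        fix w assume "w \<in> cball z (\<delta> / 2)"
        then show "w \<in> cball x \<delta>" using z(2) dist_triangle[of x w z] by (simp add: dist_commute)
      qed
      then show ?thesis by blast
    qed
    finally show ?thesis by blast
  qed
  ultimately show ?thesis by blast
qed

section \<open>The inner ball condition as a bounded first-order formula\<close>

type_synonym 'n config = "(real ^ 'n) \<times> (real ^ 'n) \<times> (real ^ 'n) \<times> real \<times> real"

text \<open>
  The quantified points are added to the configuration \<open>w\<close>, so that each quantifier moves along
  fixed directions; at \<open>w = (0, 0, 0, \<delta>, r)\<close> the sum is just \<open>(x, y, z, \<delta>, r)\<close>.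
\<close>

definition inner_ball_formula :: "(real ^ 'n) set \<Rightarrow> real \<Rightarrow> 'n config \<Rightarrow> bool" where
  "inner_ball_formula K L w \<longleftrightarrow>
     (\<forall>x. (\<forall>i. x $ i \<in> {-L..L}) \<longrightarrow> fst (w + (x, 0)) \<in> K \<longrightarrow>
       (\<exists>y. (\<forall>i. y $ i \<in> {-L..L}) \<and>
         (\<forall>z. (\<forall>i. z $ i \<in> {-L..L}) \<longrightarrow>
            (case w + (x, 0) + (0, y, 0) + (0, 0, z, 0) of (x', y', z', \<delta>, r) \<Rightarrow>
               (norm (z' - y'))\<^sup>2 \<le> r\<^sup>2 \<longrightarrow> z' \<in> K \<and> (norm (z' - x'))\<^sup>2 \<le> \<delta>\<^sup>2))))"

lemma sign_determined_inner_ball_formula: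
  fixes K :: "(real ^ 'n) set"
  assumes "semialgebraic K" "0 < L"
  shows "sign_determined (inner_ball_formula K L)"
proof -
  have K: "sign_determined (\<lambda>x. x \<in> K)" by (rule sign_determined_semialgebraic[OF assms(1)])
  have "sign_determined (\<lambda>w :: 'n config.
     (norm (fst (snd (snd w)) - fst (snd w)))\<^sup>2 \<le> (snd (snd (snd (snd w))))\<^sup>2 \<longrightarrow>
       fst (snd (snd w)) \<in> K \<and> (norm (fst (snd (snd w)) - fst w))\<^sup>2 \<le> (fst (snd (snd (snd w))))\<^sup>2)"
    by (intro sign_determined_imp sign_determined_conj sign_determined_norm_le
        sign_determined_compose_linear[OF K] bounded_linear_sub bounded_linear_fst_comp bounded_linear_snd_comp
        bounded_linear_ident)
  hence body: "sign_determined (\<lambda>w :: 'n config. case w of (x', y', z', \<delta>, r) \<Rightarrow>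
               (norm (z' - y'))\<^sup>2 \<le> r\<^sup>2 \<longrightarrow> z' \<in> K \<and> (norm (z' - x'))\<^sup>2 \<le> \<delta>\<^sup>2)"
    by (simp add: case_prod_unfold)
  have lin: "linear (\<lambda>x :: real ^ 'n. (x, 0) :: 'n config)"
    "linear (\<lambda>y :: real ^ 'n. (0, y, 0) :: 'n config)"
    "linear (\<lambda>z :: real ^ 'n. (0, 0, z, 0) :: 'n config)"
    by (intro linearI; simp add: zero_prod_def)+
  have "-L < L" using assms(2) by simp
  have "sign_determined (\<lambda>w :: 'n config. fst w \<in> K)"
    by (intro sign_determined_compose_linear[OF K] bounded_linear_fst)
  from sign_determined_all_box[OF \<open>-L < L\<close> lin(1) sign_determined_imp[OF this
    sign_determined_ex_box[OF \<open>-L < L\<close> lin(2) sign_determined_all_box[OF \<open>-L < L\<close> lin(3) body]]]]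
  show ?thesis unfolding inner_ball_formula_def .
qed

text \<open>Restricting the quantifiers to the box loses nothing: \<open>x\<close> and
  \<open>y\<close> lie in \<open>K\<close>, and every \<open>z\<close> within distance
  \<open>r\<close> of \<open>y\<close> stays in the box because \<open>K\<close> keeps a margin of 1
  and \<open>r\<close> is at most 1.\<close>

lemma inner_ball_formula_iff:
  fixes K :: "(real ^ 'n) set"
  assumes K: "\<And>x i. x \<in> K \<Longrightarrow> \<bar>x $ i\<bar> \<le> L - 1" and "0 < \<delta>" "0 < r" "r \<le> 1"
  shows "inner_ball_formula K L (0, 0, 0, \<delta>, r) \<longleftrightarrow> (\<forall>x\<in>K. \<exists>y. cball y r \<subseteq> K \<inter> cball x \<delta>)"
proof -
  define box where "box = {v :: real ^ 'n. \<forall>i. v $ i \<in> {-L..L}}"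
  have Kbox: "x \<in> box" if "x \<in> K" for x
    using K[OF that] by (auto simp: box_def abs_le_iff) (smt (verit))+
  have near: "z \<in> box" if "y \<in> K" "norm (z - y) \<le> r" for y z
  proof -
    have "\<bar>z $ i\<bar> \<le> L" for i
      using component_le_norm_cart[of "z - y" i] that(2) K[OF that(1), of i] assms(4) by simp
    then show ?thesis by (auto simp: box_def abs_le_iff minus_le_iff)
  qed
  have sq: "(norm v)\<^sup>2 \<le> s\<^sup>2 \<longleftrightarrow> norm v \<le> s" if "0 < s" for v :: "real ^ 'n" and s
    using that by (simp add: power2_le_iff_abs_le)
  have "inner_ball_formula K L (0, 0, 0, \<delta>, r) \<longleftrightarrow>
    (\<forall>x\<in>box. x \<in> K \<longrightarrow> (\<exists>y\<in>box. \<forall>z\<in>box. norm (z - y) \<le> r \<longrightarrow> z \<in> K \<and> norm (z - x) \<le> \<delta>))"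
    unfolding inner_ball_formula_def box_def using assms(2,3) by (simp add: sq zero_prod_def)
  also have "\<dots> \<longleftrightarrow> (\<forall>x\<in>K. \<exists>y. cball y r \<subseteq> K \<inter> cball x \<delta>)"
  proof (intro iffI ballI impI)
    fix x assume "\<forall>x\<in>box. x \<in> K \<longrightarrow> (\<exists>y\<in>box. \<forall>z\<in>box. norm (z - y) \<le> r \<longrightarrow> z \<in> K \<and> norm (z - x) \<le> \<delta>)" "x \<in> K"
    then obtain y where y: "y \<in> box" "\<And>z. z \<in> box \<Longrightarrow> norm (z - y) \<le> r \<Longrightarrow> z \<in> K \<and> norm (z - x) \<le> \<delta>"
      using Kbox by blast
    \<comment> \<open>Instantiating the innermost quantifier at the centre \<open>y\<close>
      itself.\<close>
    have "y \<in> K" using y(2)[OF y(1)] assms(3) by simp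
    have "cball y r \<subseteq> K \<inter> cball x \<delta>"
    proof
      fix z assume "z \<in> cball y r"
      hence z: "norm (z - y) \<le> r" by (simp add: dist_norm norm_minus_commute)
      have "z \<in> K \<and> norm (z - x) \<le> \<delta>" by (rule y(2)[OF near[OF \<open>y \<in> K\<close> z] z])
      then show "z \<in> K \<inter> cball x \<delta>" by (simp add: dist_norm norm_minus_commute[of x])
    qed
    then show "\<exists>y. cball y r \<subseteq> K \<inter> cball x \<delta>" ..
  next
    fix x assume "\<forall>x\<in>K. \<exists>y. cball y r \<subseteq> K \<inter> cball x \<delta>" "x \<in> K"
    then obtain y where y: "cball y r \<subseteq> K \<inter> cball x \<delta>" by blast
    hence "y \<in> box" using assms(3) by (intro Kbox) auto
    moreover have "z \<in> K \<and> norm (z - x) \<le> \<delta>" if "norm (z - y) \<le> r" for z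
    proof -
      have "z \<in> cball y r" using that by (simp add: dist_norm norm_minus_commute[of y])
      hence "z \<in> K \<inter> cball x \<delta>" using y by blast
      then show ?thesis by (simp add: dist_norm norm_minus_commute[of z])
    qed
    ultimately show "\<exists>y\<in>box. \<forall>z\<in>box. norm (z - y) \<le> r \<longrightarrow> z \<in> K \<and> norm (z - x) \<le> \<delta>" by blast
  qed
  finally show ?thesis .
qed

lemma semialgebraic_inner_ball_power:
  fixes K :: "(real ^ 'n) set"
  assumes "compact K" "fat K" "semialgebraic K"
  shows "\<exists>\<epsilon> c. \<exists>N. 0 < \<epsilon> \<and> 0 < c \<and> 0 < N \<and>
    (\<forall>\<delta>. 0 < \<delta> \<and> \<delta> \<le> \<epsilon> \<longrightarrow> (\<forall>x\<in>K. \<exists>y. cball y (c * \<delta> ^ N) \<subseteq> K \<inter> cball x \<delta>))"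
proof -
  obtain M where "\<And>x. x \<in> K \<Longrightarrow> norm x \<le> M" "0 < M"
    using compact_imp_bounded[OF assms(1)] by (auto simp: bounded_pos)
  then have L: "\<And>x i. x \<in> K \<Longrightarrow> \<bar>x $ i\<bar> \<le> (M + 1) - 1" "0 < M + 1"
    using component_le_norm_cart order_trans by fastforce+
  define \<Phi> where "\<Phi> = inner_ball_formula K (M + 1)"
  have \<Phi>: "\<Phi> (0, 0, 0, \<delta>, r) \<longleftrightarrow> (\<forall>x\<in>K. \<exists>y. cball y r \<subseteq> K \<inter> cball x \<delta>)" if "0 < \<delta>" "0 < r" "r \<le> 1" for \<delta> r
    unfolding \<Phi>_def by (rule inner_ball_formula_iff[OF L(1) that])
  obtain C where C: "finite C" "\<And>f. f \<in> C \<Longrightarrow> real_polynomial_function f"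
      "\<And>v w. same_signs C v w \<Longrightarrow> \<Phi> v \<longleftrightarrow> \<Phi> w"
    using sign_determinedE[OF sign_determined_inner_ball_formula[OF assms(3) L(2)]] unfolding \<Phi>_def by blast
  have scale: "\<delta> *\<^sub>R (0, 0, 0, 1, 0) + r *\<^sub>R (0, 0, 0, 0, 1) = ((0, 0, 0, \<delta>, r) :: 'n config)" for \<delta> r
    by simp
  obtain \<epsilon> c N where N: "0 < \<epsilon>" "\<epsilon> \<le> 1" "0 < c"
    "\<And>\<delta> r r'. \<lbrakk>0 < \<delta>; \<delta> \<le> \<epsilon>; 0 < r; r \<le> c * \<delta> ^ N; 0 < r'; r' \<le> c * \<delta> ^ N\<rbrakk>
       \<Longrightarrow> same_signs C (0, 0, 0, \<delta>, r) (0, 0, 0, \<delta>, r')"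
    using same_signs_below_power[OF C(1,2), of "(0, 0, 0, 1, 0)" "(0, 0, 0, 0, 1)"] unfolding scale by blast
  \<comment> \<open>With \<open>\<delta>\<close> at most 1, the cap on \<open>c'\<close> keeps the
    radius at most 1, as the equivalence for \<open>\<Phi>\<close> demands. The exponent
    \<open>Suc N\<close> used next ensures a positive power of \<open>\<delta>\<close>.\<close>
  define c' where "c' = min 1 c"
  have "\<forall>x\<in>K. \<exists>y. cball y (c' * \<delta> ^ Suc N) \<subseteq> K \<inter> cball x \<delta>" if \<delta>: "0 < \<delta>" "\<delta> \<le> \<epsilon>" for \<delta>
  proof -
    define \<rho> where "\<rho> = c' * \<delta> ^ Suc N"
    have "\<delta> \<le> 1" using \<delta>(2) N(2) by simp
    have "\<rho> > 0" using N(3) \<delta>(1) by (simp add: \<rho>_def c'_def)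
    have "\<delta> ^ Suc N \<le> 1" using \<delta>(1) \<open>\<delta> \<le> 1\<close> by (intro power_le_one) auto
    hence "\<rho> \<le> 1 * 1" unfolding \<rho>_def using \<delta>(1) N(3) by (intro mult_mono) (auto simp: c'_def)
    hence "\<rho> \<le> 1" by simp
    have "\<delta> ^ Suc N \<le> \<delta> ^ N" using \<delta>(1) \<open>\<delta> \<le> 1\<close> by (intro power_decreasing) auto
    hence "\<rho> \<le> c * \<delta> ^ N" unfolding \<rho>_def using \<delta>(1) N(3) by (intro mult_mono) (auto simp: c'_def)
    obtain r0 where r0: "r0 > 0" "\<forall>x\<in>K. \<exists>y. cball y r0 \<subseteq> K \<inter> cball x \<delta>"
      using compact_fat_uniform_inner_ball[OF assms(1,2) \<delta>(1)] by blast
    \<comment> \<open>Compactness yields only an uncontrolled radius \<open>r0\<close>. Cutting it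
      down to at most \<open>\<rho>\<close> brings it into the range where signs are stable, so the
      truth of \<open>\<Phi>\<close> passes upwards from \<open>r\<close> to
      \<open>\<rho>\<close>.\<close>
    define r where "r = min r0 \<rho>"
    have r: "0 < r" "r \<le> \<rho>" "r \<le> r0" using r0(1) \<open>\<rho> > 0\<close> by (auto simp: r_def)
    have "\<forall>x\<in>K. \<exists>y. cball y r \<subseteq> K \<inter> cball x \<delta>" using r0(2) subset_cball[OF r(3)] by (meson subset_trans)
    hence "\<Phi> (0, 0, 0, \<delta>, r)" using \<Phi>[OF \<delta>(1) r(1)] r(2) \<open>\<rho> \<le> 1\<close> by simp
    moreover have "same_signs C (0, 0, 0, \<delta>, r) (0, 0, 0, \<delta>, \<rho>)"
      using r(1,2) \<open>\<rho> > 0\<close> \<open>\<rho> \<le> c * \<delta> ^ N\<close> by (intro N(4) \<delta>) auto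
    ultimately have "\<Phi> (0, 0, 0, \<delta>, \<rho>)" using C(3) by blast
    then show ?thesis using \<Phi>[OF \<delta>(1) \<open>\<rho> > 0\<close> \<open>\<rho> \<le> 1\<close>] by (simp add: \<rho>_def)
  qed
  moreover have "0 < c'" using N(3) by (simp add: c'_def)
  ultimately show ?thesis using N(1) zero_less_Suc by blast
qed

text \<open>The inner ball of radius \<open>c * \<delta> ^ N\<close> supplies the volume. Scaling in
  dimension \<open>CARD('n)\<close> gives the constant \<open>c ^ CARD('n)\<close> and the exponent
  \<open>N * CARD('n)\<close>, which is at least the dimension because \<open>N\<close> is
  positive.\<close>

theorem corollary2:
  fixes K :: "(real ^ 'n) set"
  assumes "compact K" and "fat K" and "semialgebraic K"
  shows "\<exists>(\<epsilon>::real) (\<eta>::real) (N::nat). \<epsilon> > 0 \<and> \<eta> > 0 \<and> N \<ge> CARD('n) \<and>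
           (\<forall>x\<in>K. \<forall>\<delta>. 0 < \<delta> \<and> \<delta> \<le> \<epsilon> \<longrightarrow>
              measure lebesgue (K \<inter> cball x \<delta>)
                \<ge> \<eta> * \<delta> ^ N * measure lebesgue (cball (0 :: real ^ 'n) 1))"
proof -
  obtain \<epsilon> c N where N: "0 < \<epsilon>" "0 < c" "0 < N"
    "\<forall>\<delta>. 0 < \<delta> \<and> \<delta> \<le> \<epsilon> \<longrightarrow> (\<forall>x\<in>K. \<exists>y. cball y (c * \<delta> ^ N) \<subseteq> K \<inter> cball x \<delta>)"
    using semialgebraic_inner_ball_power[OF assms] by blast
  have "c ^ CARD('n) * \<delta> ^ (N * CARD('n)) * measure lebesgue (cball (0 :: real ^ 'n) 1)
      \<le> measure lebesgue (K \<inter> cball x \<delta>)" if x: "x \<in> K" and \<delta>: "0 < \<delta>" "\<delta> \<le> \<epsilon>" for x \<delta>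
  proof -
    obtain y where y: "cball y (c * \<delta> ^ N) \<subseteq> K \<inter> cball x \<delta>" using N(4) \<delta> x by meson
    have "measure lebesgue (cball y (c * \<delta> ^ N)) = (c * \<delta> ^ N) ^ CARD('n) * measure lebesgue (cball (0 :: real ^ 'n) 1)"
      using content_ball_conv_unit_ball[of "c * \<delta> ^ N" y] N(2) \<delta>(1)
      by (simp add: content_cball_conv_ball)
    also have "(c * \<delta> ^ N) ^ CARD('n) = c ^ CARD('n) * \<delta> ^ (N * CARD('n))"
      by (simp add: power_mult_distrib power_mult)
    finally have "c ^ CARD('n) * \<delta> ^ (N * CARD('n)) * measure lebesgue (cball (0 :: real ^ 'n) 1)
        = measure lebesgue (cball y (c * \<delta> ^ N))" ..
    also have "\<dots> \<le> measure lebesgue (K \<inter> cball x \<delta>)"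
    proof (rule measure_mono_fmeasurable[OF y])
      show "cball y (c * \<delta> ^ N) \<in> sets lebesgue" by (rule fmeasurableD[OF lmeasurable_cball])
      show "K \<inter> cball x \<delta> \<in> lmeasurable"
        by (rule lmeasurable_compact[OF compact_Int[OF assms(1) compact_cball]])
    qed
    finally show ?thesis .
  qed
  moreover have "CARD('n) \<le> N * CARD('n)" using N(3) by simp
  moreover have "0 < c ^ CARD('n)" using N(2) by simp
  ultimately show ?thesis using N(1) by blast
qed

end
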